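(* Let $x$ be real, and let $|\phi_{\rm D}\rangle\in(\mathbb C^3)^{\otimes N}$ be the zero-energy state for the diagonal twist, with the normalisation given in the context. Then $$(\phi_{\rm D})_{\underbrace{\scriptstyle\Uparrow\cdots\Uparrow}_{n}\underbrace{\scriptstyle\Downarrow\cdots\Downarrow}_{n}}=A(n;x^2)\quad\text{for }N=2n,\qquad(\phi_{\rm D})_{\underbrace{\scriptstyle\Uparrow\cdots\Uparrow}_{n}0\underbrace{\scriptstyle\Downarrow\cdots\Downarrow}_{n}}=A(n;x^2)\quad\text{for }N=2n+1.$$
   Context: Alternating sign matrices (ASMs): square matrices with entries in $\{-1,0,1\}$, all row and column sums equal to $1$, and non-zero entries alternating in sign along each row and column. $A(n;t)=\sum t^{k}$ over $n\times n$ ASMs, $k$ = number of $-1$ entries. Notation: $[z]=z-z^{-1}$; $x=q+q^{-1}$ with $q\in\mathbb C^\times$; $\mathbb C^2$ has basis $|{\uparrow}\rangle,|{\downarrow}\rangle$ and $\mathbb C^3$ has basis $|{\Uparrow}\rangle,|0\rangle,|{\Downarrow}\rangle$; $\phi_{\sigma_1\cdots\sigma_N}$ denotes the component of $|\phi\rangle$ along $|\sigma_1\cdots\sigma_N\rangle$. $R(z)$ is the operator on $\mathbb C^2\otimes\mathbb C^3$ with diagonal entries $[q^2z],[qz],[z],[z],[qz],[q^2z]$ on $|{\uparrow\Uparrow}\rangle,|{\uparrow}0\rangle,|{\uparrow\Downarrow}\rangle,|{\downarrow\Uparrow}\rangle,|{\downarrow}0\rangle,|{\downarrow\Downarrow}\rangle$,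 and whose only non-zero off-diagonal entries are those between $|{\uparrow}0\rangle$ and $|{\downarrow\Uparrow}\rangle$ and between $|{\uparrow\Downarrow}\rangle$ and $|{\downarrow}0\rangle$ (both directions), all equal to $\sqrt{[q][q^2]}$ (a fixed root). With auxiliary space $a\simeq\mathbb C^2$, $$R_{a,N}(q^{-1}z)\cdots R_{a,1}(q^{-1}z)=\begin{pmatrix}\mathcal A(z)&\mathcal B(z)\\ \mathcal C(z)&\mathcal D(z)\end{pmatrix}_a .$$ Then $|\phi_{\rm D}\rangle=([q][q^2])^{-N/2}[q]^{-N(N-1)}\,\mathcal B(1)^N|{\Uparrow\cdots\Uparrow}\rangle$ (where $([q][q^2])^{1/2}$ is the same root as in $R$). Its components are polynomials in $x$, which defines it also at $q^4=1$ by continuity. (It is annihilated by the integrable spin-one XXZ Hamiltonian with diagonal twist.) *)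

theory Defs
  imports Complex_Main "Jordan_Normal_Form.Matrix" "HOL-Library.FuncSet"
begin

section \<open>Alternating sign matrices\<close>

definition alternating_vec :: "int vec \<Rightarrow> bool" where
  "alternating_vec v \<longleftrightarrow>
    (\<forall>j k. j < k \<and> k < dim_vec v \<and> v $ j \<noteq> 0 \<and> v $ k \<noteq> 0 \<and>
           (\<forall>l. j < l \<and> l < k \<longrightarrow> v $ l = 0) \<longrightarrow> sgn (v $ k) = - sgn (v $ j))"

definition ASM :: "nat \<Rightarrow> int mat set" where
  "ASM n = {M \<in> carrier_mat n n.
     elements_mat M \<subseteq> {-1, 0, 1} \<and>
     (\<forall>i<n. (\<Sum>j<n. M $$ (i, j)) = 1) \<and>
     (\<forall>j<n. (\<Sum>i<n. M $$ (i, j)) = 1) \<and>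
     (\<forall>i<n. alternating_vec (row M i)) \<and>
     (\<forall>j<n. alternating_vec (col M j))}"

lemma finite_ASM: "finite (ASM n)"
proof (rule finite_subset)
  let ?I = "{..<n} \<times> {..<n}"
  show "ASM n \<subseteq> mat n n ` (PiE ?I (\<lambda>_. {-1, 0, 1}))"
  proof
    fix M assume M: "M \<in> ASM n"
    then have c: "M \<in> carrier_mat n n" and e: "elements_mat M \<subseteq> {-1, 0, 1}"
      by (auto simp: ASM_def)
    have "M = mat n n (restrict (index_mat M) ?I)"
      using c by (intro eq_matI) auto
    moreover have "M $$ (i, j) \<in> {-1, 0, 1}" if "i < n" "j < n" for i j
      using subsetD[OF e elements_matI[OF c that refl]] .
    then have "restrict (index_mat M) ?I \<in> PiE ?I (\<lambda>_. {-1, 0, 1})"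
      by (intro restrict_PiE_iff[THEN iffD2]) blast
    ultimately show "M \<in> mat n n ` (PiE ?I (\<lambda>_. {-1, 0, 1}))"
      by blast
  qed
qed (auto intro!: finite_imageI finite_PiE)

definition num_neg :: "int mat \<Rightarrow> nat" where
  "num_neg M = card {(i, j). i < dim_row M \<and> j < dim_col M \<and> M $$ (i, j) = -1}"

definition ASM_gf :: "nat \<Rightarrow> real \<Rightarrow> real" where
  "ASM_gf n t = (\<Sum>M\<in>ASM n. t ^ num_neg M)"


section \<open>The R-matrix and the monodromy\<close>

definition br :: "complex \<Rightarrow> complex" where
  "br z = z - inverse z"

datatype spin_half = Up | Down
datatype spin_one = UUp | Zero | DDown

text \<open>\<open>R_entry q s z u v\<close> is the matrix element \<open>\<langle>u|R(z)|v\<rangle>\<close>;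
  \<open>s\<close> is the chosen square root of \<open>[q][q\<^sup>2]\<close>.\<close>

definition R_entry ::
  "complex \<Rightarrow> complex \<Rightarrow> complex \<Rightarrow> spin_half \<times> spin_one \<Rightarrow> spin_half \<times> spin_one \<Rightarrow> complex"
where
  "R_entry q s z u v =
    (if u = v then
       (case u of
          (Up, UUp) \<Rightarrow> br (q\<^sup>2 * z)
        | (Up, Zero) \<Rightarrow> br (q * z)
        | (Up, DDown) \<Rightarrow> br z
        | (Down, UUp) \<Rightarrow> br z
        | (Down, Zero) \<Rightarrow> br (q * z)
        | (Down, DDown) \<Rightarrow> br (q\<^sup>2 * z))
     else if {u, v} = {(Up, Zero), (Down, UUp)} \<or> {u, v} = {(Up, DDown), (Down, Zero)} then s
     else 0)"

text \<open>A vector of the \<open>N\<close>-fold tensor power of \<open>\<complex>\<^sup>3\<close> is given by its components, indexed by the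
  lists of length \<open>N\<close> over \<^typ>\<open>spin_one\<close> (values at lists of other lengths carry no meaning).
  Site \<open>j = 1, \<dots>, N\<close> is list position \<open>j - 1\<close>.\<close>

type_synonym state = "spin_one list \<Rightarrow> complex"
type_synonym aux_state = "spin_half \<Rightarrow> spin_one list \<Rightarrow> complex"

definition R_site :: "complex \<Rightarrow> complex \<Rightarrow> complex \<Rightarrow> nat \<Rightarrow> aux_state \<Rightarrow> aux_state" where
  "R_site q s z j \<psi> = (\<lambda>a' \<sigma>.
     \<Sum>a\<in>{Up, Down}. \<Sum>\<tau>\<in>{UUp, Zero, DDown}.
       R_entry q s z (a', \<sigma> ! j) (a, \<tau>) * \<psi> a (\<sigma>[j := \<tau>]))"

text \<open>\<open>monodromy q s z N\<close> is \<open>R\<^bsub>a,N\<^esub>(q\<^sup>-\<^sup>1z) \<cdots> R\<^bsub>a,1\<^esub>(q\<^sup>-\<^sup>1z)\<close>; site \<open>1\<close> acts first.\<close>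

fun monodromy :: "complex \<Rightarrow> complex \<Rightarrow> complex \<Rightarrow> nat \<Rightarrow> aux_state \<Rightarrow> aux_state" where
  "monodromy q s z 0 = id"
| "monodromy q s z (Suc k) = R_site q s (inverse q * z) k \<circ> monodromy q s z k"

text \<open>The upper right block of the monodromy: \<open>\<langle>\<up>|\<cdots>|\<down>\<rangle>\<close> in the auxiliary space.\<close>

definition B_op :: "complex \<Rightarrow> complex \<Rightarrow> complex \<Rightarrow> nat \<Rightarrow> state \<Rightarrow> state" where
  "B_op q s z N \<psi> = monodromy q s z N (\<lambda>a \<sigma>. if a = Down then \<psi> \<sigma> else 0) Up"

definition basis_state :: "spin_one list \<Rightarrow> state" where
  "basis_state \<tau> = (\<lambda>\<sigma>. if \<sigma> = \<tau> then 1 else 0)"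


section \<open>The zero-energy state for the diagonal twist\<close>

text \<open>\<open>r\<close> chooses, for every \<open>q\<close>, a square root of \<open>[q][q\<^sup>2]\<close>. It is a function of \<open>q\<close> because
  the continuation to \<open>q\<^sup>4 = 1\<close> involves the values at all nearby \<open>q\<close>; no continuity of \<open>r\<close>
  is needed.\<close>

definition sqrt_choice :: "(complex \<Rightarrow> complex) \<Rightarrow> bool" where
  "sqrt_choice r \<longleftrightarrow> (\<forall>q. q \<noteq> 0 \<longrightarrow> (r q)\<^sup>2 = br q * br (q\<^sup>2))"

definition phi_D_generic :: "(complex \<Rightarrow> complex) \<Rightarrow> nat \<Rightarrow> complex \<Rightarrow> state" where
  "phi_D_generic r N q = (\<lambda>\<sigma>.
     inverse (r q ^ N) * inverse (br q ^ (N * (N - 1))) *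
     (B_op q (r q) 1 N ^^ N) (basis_state (replicate N UUp)) \<sigma>)"

text \<open>At \<open>q\<^sup>4 = 1\<close> the prefactor is singular and each component is defined by its limit.\<close>

definition phi_D :: "(complex \<Rightarrow> complex) \<Rightarrow> nat \<Rightarrow> complex \<Rightarrow> state" where
  "phi_D r N q = (\<lambda>\<sigma>.
     if q ^ 4 \<noteq> 1 then phi_D_generic r N q \<sigma>
     else Lim (at q) (\<lambda>p. phi_D_generic r N p \<sigma>))"

end

theory Submission
  imports Defs "HOL-Computational_Algebra.Polynomial"
begin

text \<open>At \<open>z = 1\<close> the component factorises: the first \<open>n\<close> columns are frozen (and, for odd \<open>N\<close>, so is
  the last row), which leaves the domain-wall partition function of the mixed spin-1/2, spin-1 model
  with \<open>2n\<close> rows and \<open>n\<close> columns. In the inhomogeneous model with row parameters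
  \<open>w\<^sub>1, \<dots>, w\<^sub>n, v\<^sub>1/q, \<dots>, v\<^sub>n/q\<close> and column parameters \<open>v\<^sub>1, \<dots>, v\<^sub>n\<close> this function is an explicit
  factor times the domain-wall partition function of the six-vertex model with crossing parameter \<open>q\<^sup>2\<close>
  and parameters \<open>w\<close>, \<open>v\<close>. Up to a monomial both sides are polynomials of degree less than \<open>n\<close>
  in \<open>w\<^sub>1\<^sup>2\<close>, and the Yang-Baxter equation makes them symmetric in the columns (and the left one in the
  rows), so it suffices to compare them at \<open>w\<^sub>1 = v\<^sub>j/q\<^sup>2\<close>, where a column freezes and \<open>n\<close> drops by
  one. At \<open>w = q\<^sup>-\<^sup>1\<close>, \<open>v = 1\<close> the six-vertex weights are \<open>[q], [q], [q\<^sup>2]\<close>, and the configurations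
  are the alternating sign matrices with \<open>[q\<^sup>2]/[q] = x\<close> per non-zero entry.\<close>

section \<open>Finiteness of the two spin spaces\<close>

instance spin_half :: finite
proof
  have "UNIV = {Up, Down}" by (auto intro: spin_half.exhaust)
  then show "finite (UNIV :: spin_half set)" by (metis finite.emptyI finite.insertI)
qed

instance spin_one :: finite
proof
  have "UNIV = {UUp, Zero, DDown}" by (auto intro: spin_one.exhaust)
  then show "finite (UNIV :: spin_one set)" by (metis finite.emptyI finite.insertI)
qed

lemma UNIV_spin_half: "UNIV = {Up, Down}"
  by (auto intro: spin_half.exhaust)

lemma UNIV_spin_one: "UNIV = {UUp, Zero, DDown}"
  by (auto intro: spin_one.exhaust)

section \<open>Row operators of a vertex model\<close>

text \<open>\<open>W a t c s\<close> is the weight of the vertex with incoming auxiliary and site states \<open>a\<close>, \<open>t\<close> and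
  outgoing states \<open>c\<close>, \<open>s\<close>.\<close>

type_synonym ('a, 'b) weight = "'a \<Rightarrow> 'b \<Rightarrow> 'a \<Rightarrow> 'b \<Rightarrow> complex"

text \<open>The auxiliary state runs from \<open>a\<close> at the head of the list to
  \<open>b\<close> at its end; \<open>\<psi>\<close> is read at the incoming site states, and
  \<open>\<sigma>\<close> is outgoing. The recursion is on the weights alone, so the lists
  \<open>\<sigma>\<close> of interest are those of the length of \<open>Ws\<close>.\<close>

fun row_op :: "('a::finite, 'b::finite) weight list \<Rightarrow> 'a \<Rightarrow> 'a \<Rightarrow> ('b list \<Rightarrow> complex) \<Rightarrow> 'b list \<Rightarrow> complex"
where
  "row_op [] a b \<psi> \<sigma> = (if a = b then \<psi> \<sigma> else 0)"
| "row_op (W # Ws) a b \<psi> \<sigma> =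
     (\<Sum>c\<in>UNIV. \<Sum>t\<in>UNIV. W a t c (hd \<sigma>) * row_op Ws c b (\<lambda>\<tau>. \<psi> (t # \<tau>)) (tl \<sigma>))"

lemma row_op_sum:
  "row_op Ws a b (\<lambda>\<tau>. \<Sum>i\<in>I. f i * \<psi> i \<tau>) \<sigma> = (\<Sum>i\<in>I. f i * row_op Ws a b (\<psi> i) \<sigma>)"
proof (induction Ws arbitrary: a \<psi> \<sigma>)
  case (Cons W Ws)
  have "row_op (W # Ws) a b (\<lambda>\<tau>. \<Sum>i\<in>I. f i * \<psi> i \<tau>) \<sigma> =
    (\<Sum>c\<in>UNIV. \<Sum>t\<in>UNIV. \<Sum>i\<in>I. f i * (W a t c (hd \<sigma>) * row_op Ws c b (\<lambda>\<tau>. \<psi> i (t # \<tau>)) (tl \<sigma>)))"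
    by (simp add: Cons.IH sum_distrib_left mult_ac)
  also have "\<dots> = (\<Sum>c\<in>UNIV. \<Sum>i\<in>I. \<Sum>t\<in>UNIV. f i * (W a t c (hd \<sigma>) * row_op Ws c b (\<lambda>\<tau>. \<psi> i (t # \<tau>)) (tl \<sigma>)))"
    by (intro sum.cong refl sum.swap)
  also have "\<dots> = (\<Sum>i\<in>I. \<Sum>c\<in>UNIV. \<Sum>t\<in>UNIV. f i * (W a t c (hd \<sigma>) * row_op Ws c b (\<lambda>\<tau>. \<psi> i (t # \<tau>)) (tl \<sigma>)))"
    by (rule sum.swap)
  finally show ?case by (simp add: sum_distrib_left)
qed simp

lemma row_op_scale: "row_op Ws a b (\<lambda>\<tau>. k * \<psi> \<tau>) \<sigma> = k * row_op Ws a b \<psi> \<sigma>"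
  using row_op_sum[of Ws a b "\<lambda>_. k" "\<lambda>_. \<psi>" "{()}" \<sigma>] by simp

lemma row_op_sum2:
  "row_op Ws a b (\<lambda>\<tau>. \<Sum>i\<in>I. \<Sum>j\<in>J. f i j * \<psi> i j \<tau>) \<sigma> = (\<Sum>i\<in>I. \<Sum>j\<in>J. f i j * row_op Ws a b (\<psi> i j) \<sigma>)"
  using row_op_sum[of Ws a b "\<lambda>_. 1" "\<lambda>i \<tau>. \<Sum>j\<in>J. f i j * \<psi> i j \<tau>" I \<sigma>]
  by (simp add: row_op_sum)

lemma row_op_cong:
  assumes "length \<sigma> = length Ws" "\<And>\<tau>. length \<tau> = length Ws \<Longrightarrow> \<psi> \<tau> = \<psi>' \<tau>"
  shows "row_op Ws a b \<psi> \<sigma> = row_op Ws a b \<psi>' \<sigma>"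
  using assms
proof (induction Ws arbitrary: a \<psi> \<psi>' \<sigma>)
  case (Cons W Ws)
  have "row_op Ws c b (\<lambda>\<tau>. \<psi> (t # \<tau>)) (tl \<sigma>) = row_op Ws c b (\<lambda>\<tau>. \<psi>' (t # \<tau>)) (tl \<sigma>)" for c t
    using Cons.prems by (intro Cons.IH) auto
  then show ?case by simp
qed simp

text \<open>\<open>monodromy\<close> appends sites at the end while \<open>row_op\<close> recurses
  from the front; this is the bridge between the two orders.\<close>

lemma row_op_snoc:
  assumes "length \<sigma> = Suc (length Ws)"
  shows "row_op (Ws @ [W]) a b \<psi> \<sigma> =
    (\<Sum>c\<in>UNIV. \<Sum>t\<in>UNIV. W c t b (last \<sigma>) * row_op Ws a c (\<lambda>\<tau>. \<psi> (\<tau> @ [t])) (butlast \<sigma>))"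
  using assms
proof (induction Ws arbitrary: a \<psi> \<sigma>)
  case Nil
  then obtain s where s: "\<sigma> = [s]" by (auto simp: length_Suc_conv)
  have "(\<Sum>c\<in>UNIV. \<Sum>t\<in>UNIV. W a t c s * (if c = b then \<psi> [t] else 0)) = (\<Sum>t\<in>UNIV. W a t b s * \<psi> [t])"
    by (subst sum.swap) (simp add: if_distrib[of "\<lambda>x. _ * x"] sum.delta cong: if_cong)
  moreover have "(\<Sum>c\<in>UNIV. \<Sum>t\<in>UNIV. W c t b s * (if a = c then \<psi> [t] else 0)) = (\<Sum>t\<in>UNIV. W a t b s * \<psi> [t])"
    by (subst sum.swap) (simp add: if_distrib[of "\<lambda>x. _ * x"] sum.delta cong: if_cong)
  ultimately show ?case by (simp add: s cong: if_cong)
next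
  case (Cons V Ws)
  then obtain s \<rho> where s: "\<sigma> = s # \<rho>" "length \<rho> = Suc (length Ws)" by (auto simp: length_Suc_conv)
  let ?g = "\<lambda>d r c t. V a r d s * (W c t b (last \<rho>) * row_op Ws d c (\<lambda>\<tau>. \<psi> (r # \<tau> @ [t])) (butlast \<rho>))"
  have "row_op ((V # Ws) @ [W]) a b \<psi> \<sigma> = (\<Sum>d\<in>UNIV. \<Sum>r\<in>UNIV. \<Sum>c\<in>UNIV. \<Sum>t\<in>UNIV. ?g d r c t)"
    using s by (simp add: Cons.IH sum_distrib_left)
  also have "\<dots> = (\<Sum>d\<in>UNIV. \<Sum>c\<in>UNIV. \<Sum>r\<in>UNIV. \<Sum>t\<in>UNIV. ?g d r c t)"
    by (intro sum.cong refl sum.swap)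
  also have "\<dots> = (\<Sum>d\<in>UNIV. \<Sum>c\<in>UNIV. \<Sum>t\<in>UNIV. \<Sum>r\<in>UNIV. ?g d r c t)"
    by (intro sum.cong refl sum.swap)
  also have "\<dots> = (\<Sum>c\<in>UNIV. \<Sum>d\<in>UNIV. \<Sum>t\<in>UNIV. \<Sum>r\<in>UNIV. ?g d r c t)"
    by (rule sum.swap)
  also have "\<dots> = (\<Sum>c\<in>UNIV. \<Sum>t\<in>UNIV. \<Sum>d\<in>UNIV. \<Sum>r\<in>UNIV. ?g d r c t)"
    by (intro sum.cong refl sum.swap)
  finally show ?case using s
    by (auto simp: sum_distrib_left mult_ac)
qed

section \<open>Two stacked rows and their exchange\<close>

definition fuse :: "('a, 'b::finite) weight \<Rightarrow> ('a, 'b) weight \<Rightarrow> ('a \<times> 'a, 'b) weight" where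
  "fuse V W = (\<lambda>(a1, a2) t (c1, c2) s. \<Sum>r\<in>UNIV. V a1 r c1 s * W a2 t c2 r)"

lemma sum_UNIV_pair: "(\<Sum>p\<in>UNIV. f p) = (\<Sum>x\<in>UNIV. \<Sum>y\<in>UNIV. f (x, y))"
  by (simp add: sum.cartesian_product)

text \<open>Stacked rows form a single row whose auxiliary space is the pair; \<open>r\<close> in
  \<open>fuse\<close> is the site state between the lower vertex \<open>W\<close> and the upper
  vertex \<open>V\<close>.\<close>

lemma row_op_row_op:
  assumes "length Vs = length Ws"
  shows "row_op Vs a1 b1 (row_op Ws a2 b2 \<psi>) \<sigma> = row_op (map2 fuse Vs Ws) (a1, a2) (b1, b2) \<psi> \<sigma>"
  using assms
proof (induction Vs Ws arbitrary: a1 a2 \<psi> \<sigma> rule: list_induct2)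
  case (Cons V Vs W Ws)
  let ?g = "\<lambda>c r d t. V a1 r c (hd \<sigma>) * (W a2 t d r * row_op (map2 fuse Vs Ws) (c, d) (b1, b2) (\<lambda>\<tau>. \<psi> (t # \<tau>)) (tl \<sigma>))"
  have "row_op (V # Vs) a1 b1 (row_op (W # Ws) a2 b2 \<psi>) \<sigma> =
    (\<Sum>c\<in>UNIV. \<Sum>r\<in>UNIV. \<Sum>d\<in>UNIV. \<Sum>t\<in>UNIV. ?g c r d t)"
    by (simp add: row_op_sum2 Cons.IH sum_distrib_left)
  also have "\<dots> = (\<Sum>c\<in>UNIV. \<Sum>d\<in>UNIV. \<Sum>r\<in>UNIV. \<Sum>t\<in>UNIV. ?g c r d t)"
    by (intro sum.cong refl sum.swap)
  also have "\<dots> = (\<Sum>c\<in>UNIV. \<Sum>d\<in>UNIV. \<Sum>t\<in>UNIV. \<Sum>r\<in>UNIV. ?g c r d t)"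
    by (intro sum.cong refl sum.swap)
  finally show ?case
    by (simp add: sum_UNIV_pair fuse_def sum_distrib_right sum_distrib_left mult_ac)
qed auto

text \<open>The railway argument: a local relation at every site lets \<open>X\<close> travel along
  the whole row, from its entrance to its exit.\<close>

lemma row_op_intertwine:
  assumes "list_all2 (\<lambda>V W. \<forall>a t c s. (\<Sum>d\<in>UNIV. X a d * V d t c s) = (\<Sum>d\<in>UNIV. W a t d s * X d c)) Vs Ws"
  shows "(\<Sum>d\<in>UNIV. X a d * row_op Vs d b \<psi> \<sigma>) = (\<Sum>d\<in>UNIV. row_op Ws a d \<psi> \<sigma> * X d b)"
  using assms
proof (induction Vs Ws arbitrary: a \<psi> \<sigma> rule: list_all2_induct)
  case Nil
  show ?case by (simp add: if_distrib[of "\<lambda>x. _ * x"] if_distrib[of "\<lambda>x. x * _"] sum.delta cong: if_cong)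
next
  case (Cons V Vs W Ws)
  let ?s = "hd \<sigma>" and ?R = "\<lambda>c t. row_op Vs c b (\<lambda>\<tau>. \<psi> (t # \<tau>)) (tl \<sigma>)"
  have "(\<Sum>d\<in>UNIV. X a d * row_op (V # Vs) d b \<psi> \<sigma>) =
    (\<Sum>d\<in>UNIV. \<Sum>c\<in>UNIV. \<Sum>t\<in>UNIV. X a d * V d t c ?s * ?R c t)"
    by (simp add: sum_distrib_left mult.assoc)
  also have "\<dots> = (\<Sum>c\<in>UNIV. \<Sum>d\<in>UNIV. \<Sum>t\<in>UNIV. X a d * V d t c ?s * ?R c t)"
    by (rule sum.swap)
  also have "\<dots> = (\<Sum>c\<in>UNIV. \<Sum>t\<in>UNIV. \<Sum>d\<in>UNIV. X a d * V d t c ?s * ?R c t)"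
    by (intro sum.cong refl sum.swap)
  also have "\<dots> = (\<Sum>c\<in>UNIV. \<Sum>t\<in>UNIV. \<Sum>d\<in>UNIV. W a t d ?s * X d c * ?R c t)"
    using Cons.hyps(1) by (simp flip: sum_distrib_right)
  also have "\<dots> = (\<Sum>c\<in>UNIV. \<Sum>d\<in>UNIV. \<Sum>t\<in>UNIV. W a t d ?s * X d c * ?R c t)"
    by (intro sum.cong refl sum.swap)
  also have "\<dots> = (\<Sum>d\<in>UNIV. \<Sum>c\<in>UNIV. \<Sum>t\<in>UNIV. W a t d ?s * X d c * ?R c t)"
    by (rule sum.swap)
  also have "\<dots> = (\<Sum>d\<in>UNIV. \<Sum>t\<in>UNIV. \<Sum>c\<in>UNIV. W a t d ?s * X d c * ?R c t)"
    by (intro sum.cong refl sum.swap)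
  also have "\<dots> = (\<Sum>d\<in>UNIV. \<Sum>t\<in>UNIV. W a t d ?s * (\<Sum>c\<in>UNIV. X d c * ?R c t))"
    by (simp add: sum_distrib_left mult.assoc)
  also have "\<dots> = (\<Sum>d\<in>UNIV. \<Sum>t\<in>UNIV. \<Sum>e\<in>UNIV. W a t d ?s * (row_op Ws d e (\<lambda>\<tau>. \<psi> (t # \<tau>)) (tl \<sigma>) * X e b))"
    by (simp add: Cons.IH sum_distrib_left)
  also have "\<dots> = (\<Sum>d\<in>UNIV. \<Sum>e\<in>UNIV. \<Sum>t\<in>UNIV. W a t d ?s * (row_op Ws d e (\<lambda>\<tau>. \<psi> (t # \<tau>)) (tl \<sigma>) * X e b))"
    by (intro sum.cong refl sum.swap)
  also have "\<dots> = (\<Sum>e\<in>UNIV. \<Sum>d\<in>UNIV. \<Sum>t\<in>UNIV. W a t d ?s * (row_op Ws d e (\<lambda>\<tau>. \<psi> (t # \<tau>)) (tl \<sigma>) * X e b))"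
    by (rule sum.swap)
  finally show ?case by (simp add: sum_distrib_left sum_distrib_right mult.assoc)
qed

section \<open>Exchange of two neighbouring sites\<close>

fun swap_op :: "('b::finite \<Rightarrow> 'b \<Rightarrow> 'b \<Rightarrow> 'b \<Rightarrow> complex) \<Rightarrow> nat \<Rightarrow> ('b list \<Rightarrow> complex) \<Rightarrow> 'b list \<Rightarrow> complex" where
  "swap_op Y 0 \<psi> \<sigma> = (\<Sum>p\<in>UNIV. \<Sum>r\<in>UNIV. Y p r (hd \<sigma>) (hd (tl \<sigma>)) * \<psi> (p # r # tl (tl \<sigma>)))"
| "swap_op Y (Suc k) \<psi> \<sigma> = swap_op Y k (\<lambda>\<tau>. \<psi> (hd \<sigma> # \<tau>)) (tl \<sigma>)"

lemma swap_op_sum: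
  "swap_op Y k (\<lambda>\<tau>. \<Sum>i\<in>I. f i * \<psi> i \<tau>) \<sigma> = (\<Sum>i\<in>I. f i * swap_op Y k (\<psi> i) \<sigma>)"
proof (induction k arbitrary: \<psi> \<sigma>)
  case 0
  let ?g = "\<lambda>p r i. f i * (Y p r (hd \<sigma>) (hd (tl \<sigma>)) * \<psi> i (p # r # tl (tl \<sigma>)))"
  have "swap_op Y 0 (\<lambda>\<tau>. \<Sum>i\<in>I. f i * \<psi> i \<tau>) \<sigma> = (\<Sum>p\<in>UNIV. \<Sum>r\<in>UNIV. \<Sum>i\<in>I. ?g p r i)"
    by (simp add: sum_distrib_left mult_ac)
  also have "\<dots> = (\<Sum>p\<in>UNIV. \<Sum>i\<in>I. \<Sum>r\<in>UNIV. ?g p r i)"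
    by (intro sum.cong refl sum.swap)
  also have "\<dots> = (\<Sum>i\<in>I. \<Sum>p\<in>UNIV. \<Sum>r\<in>UNIV. ?g p r i)"
    by (rule sum.swap)
  finally show ?case by (simp add: sum_distrib_left)
qed simp

lemma swap_op_sum2:
  "swap_op Y k (\<lambda>\<tau>. \<Sum>i\<in>I. \<Sum>j\<in>J. f i j * \<psi> i j \<tau>) \<sigma> = (\<Sum>i\<in>I. \<Sum>j\<in>J. f i j * swap_op Y k (\<psi> i j) \<sigma>)"
  using swap_op_sum[of Y k "\<lambda>_. 1" "\<lambda>i \<tau>. \<Sum>j\<in>J. f i j * \<psi> i j \<tau>" I \<sigma>]
  by (simp add: swap_op_sum)

text \<open>The Yang-Baxter equation for one auxiliary and two site spaces, with \<open>p\<close>,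
  \<open>r\<close> incoming and \<open>s\<close>, \<open>s'\<close> outgoing. The flip is absorbed
  into \<open>Y\<close>, so \<open>V\<close> and \<open>W\<close> trade positions.\<close>

definition site_exchange ::
  "('b::finite \<Rightarrow> 'b \<Rightarrow> 'b \<Rightarrow> 'b \<Rightarrow> complex) \<Rightarrow> ('a::finite, 'b) weight \<Rightarrow> ('a, 'b) weight \<Rightarrow> bool" where
  "site_exchange Y V W \<longleftrightarrow> (\<forall>a b p r s s'.
     (\<Sum>c\<in>UNIV. \<Sum>t\<in>UNIV. \<Sum>t'\<in>UNIV. V a t c s * W c t' b s' * Y p r t t') =
     (\<Sum>c\<in>UNIV. \<Sum>t\<in>UNIV. \<Sum>t'\<in>UNIV. Y t t' s s' * W a p c t * V c r b t'))"

text \<open>The induction over \<open>Us\<close> strips the sites in front of the pair, which the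
  exchange matrix does not touch; the base case is the local relation, with the remaining sites as a
  common factor \<open>?R\<close>.\<close>

lemma row_op_swap_op:
  assumes "site_exchange Y V W"
  shows "row_op (Us @ V # W # Ws) a b (swap_op Y (length Us) \<psi>) \<sigma> =
    swap_op Y (length Us) (row_op (Us @ W # V # Ws) a b \<psi>) \<sigma>"
proof (induction Us arbitrary: a \<psi> \<sigma>)
  case Nil
  obtain s s' \<rho> where s: "hd \<sigma> = s" "hd (tl \<sigma>) = s'" "tl (tl \<sigma>) = \<rho>" by auto
  let ?R = "\<lambda>d p r. row_op Ws d b (\<lambda>\<tau>. \<psi> (p # r # \<tau>)) \<rho>"
  let ?g = "\<lambda>c t d t' p r. V a t c s * W c t' d s' * Y p r t t' * ?R d p r"
  let ?h = "\<lambda>c t d t' p r. Y t t' s s' * W a p c t * V c r d t' * ?R d p r"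
  have "row_op ([] @ V # W # Ws) a b (swap_op Y (length []) \<psi>) \<sigma> =
      (\<Sum>c\<in>UNIV. \<Sum>t\<in>UNIV. \<Sum>d\<in>UNIV. \<Sum>t'\<in>UNIV. \<Sum>p\<in>UNIV. \<Sum>r\<in>UNIV. ?g c t d t' p r)"
    by (simp add: s row_op_sum2 sum_distrib_left mult_ac)
  also have "\<dots> = (\<Sum>((((c,t),d),t'),p,r)\<in>UNIV. ?g c t d t' p r)"
    by (simp add: sum_UNIV_pair)
  \<comment> \<open>One sum over tuples replaces the six nested ones, so that a single reindexing
    makes the indices \<open>c\<close>, \<open>t\<close>, \<open>t'\<close> of the local relation
    innermost.\<close>
  also have "\<dots> = (\<Sum>((d,p,r),c,t,t')\<in>UNIV. ?g c t d t' p r)"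
    by (rule sum.reindex_bij_witness[where j = "\<lambda>((((c,t),d),t'),p,r). ((d,p,r),c,t,t')" and i = "\<lambda>((d,p,r),c,t,t'). ((((c,t),d),t'),p,r)"]) auto
  also have "\<dots> = (\<Sum>d\<in>UNIV. \<Sum>p\<in>UNIV. \<Sum>r\<in>UNIV. (\<Sum>c\<in>UNIV. \<Sum>t\<in>UNIV. \<Sum>t'\<in>UNIV. V a t c s * W c t' d s' * Y p r t t') * ?R d p r)"
    by (simp add: sum_UNIV_pair sum_distrib_right)
  also have "\<dots> = (\<Sum>d\<in>UNIV. \<Sum>p\<in>UNIV. \<Sum>r\<in>UNIV. (\<Sum>c\<in>UNIV. \<Sum>t\<in>UNIV. \<Sum>t'\<in>UNIV. Y t t' s s' * W a p c t * V c r d t') * ?R d p r)"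
    using assms by (simp add: site_exchange_def)
  also have "\<dots> = (\<Sum>((d,p,r),c,t,t')\<in>UNIV. ?h c t d t' p r)"
    by (simp add: sum_UNIV_pair sum_distrib_right)
  also have "\<dots> = (\<Sum>(t,t',c,p,d,r)\<in>UNIV. ?h c t d t' p r)"
    by (rule sum.reindex_bij_witness[where i = "\<lambda>(t,t',c,p,d,r). ((d,p,r),c,t,t')" and j = "\<lambda>((d,p,r),c,t,t'). (t,t',c,p,d,r)"]) auto
  also have "\<dots> = (\<Sum>t\<in>UNIV. \<Sum>t'\<in>UNIV. \<Sum>c\<in>UNIV. \<Sum>p\<in>UNIV. \<Sum>d\<in>UNIV. \<Sum>r\<in>UNIV. ?h c t d t' p r)"
    by (simp add: sum_UNIV_pair)
  also have "\<dots> = swap_op Y (length []) (row_op ([] @ W # V # Ws) a b \<psi>) \<sigma>"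
    by (simp add: s sum_distrib_left mult_ac)
  finally show ?case .
next
  case (Cons U Us)
  then show ?case by (simp add: swap_op_sum2)
qed

text \<open>\<open>Y\<close> maps the pair of states \<open>h\<close> to \<open>y\<close> times
  itself, so multiples of the reference state are eigenvectors. The multiple \<open>x\<close> is
  left free because stripping a first entry other than \<open>h\<close> leaves the zero
  vector.\<close>

lemma swap_op_highest:
  assumes "\<And>s s'. Y h h s s' = (if s = h \<and> s' = h then y else 0)"
    and "\<And>\<tau>. length \<tau> = n \<Longrightarrow> \<psi> \<tau> = (if \<tau> = replicate n h then x else 0)"
    and "length \<sigma> = n" "k + 2 \<le> n"
  shows "swap_op Y k \<psi> \<sigma> = y * \<psi> \<sigma>"
  using assms(2-)
proof (induction k arbitrary: \<psi> \<sigma> n x)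
  case 0
  then obtain s s' \<rho> m where s: "\<sigma> = s # s' # \<rho>" "n = Suc (Suc m)" "length \<rho> = m"
    by (cases \<sigma>; cases "tl \<sigma>") auto
  have "swap_op Y 0 \<psi> \<sigma> = (\<Sum>p\<in>UNIV. \<Sum>r\<in>UNIV. if p = h then if r = h then Y h h s s' * \<psi> (h # h # \<rho>) else 0 else 0)"
    using s 0 by (auto intro!: sum.cong)
  also have "\<dots> = Y h h s s' * \<psi> (h # h # \<rho>)"
    by (subst sum.swap) (simp add: sum.delta)
  also have "\<dots> = y * \<psi> \<sigma>" using s 0 assms(1) by auto
  finally show ?case .
next
  case (Suc k)
  then obtain s \<rho> m where s: "\<sigma> = s # \<rho>" "n = Suc m" "length \<rho> = m"
    by (cases \<sigma>) auto
  show ?case unfolding s swap_op.simps list.sel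
    using Suc.prems s by (intro Suc.IH[where n = m and x = "if s = h then x else 0"]) auto
qed

text \<open>The dual statement: evaluation at the constant list \<open>l\<close> sees only the
  entries of \<open>Y\<close> with outgoing pair \<open>l\<close>, \<open>l\<close>, whatever
  \<open>\<psi>\<close> is.\<close>

lemma swap_op_lowest:
  assumes "\<And>p r. Y p r l l = (if p = l \<and> r = l then y else 0)" "k + 2 \<le> n"
  shows "swap_op Y k \<psi> (replicate n l) = y * \<psi> (replicate n l)"
  using assms(2)
proof (induction k arbitrary: \<psi> n)
  case 0
  then obtain m where m: "n = Suc (Suc m)" by (metis add_2_eq_Suc le_Suc_ex add.commute add_0)
  have "swap_op Y 0 \<psi> (replicate n l) = (\<Sum>p\<in>UNIV. \<Sum>r\<in>UNIV. if p = l then if r = l then y * \<psi> (replicate n l) else 0 else 0)"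
    using m assms(1) by (auto intro!: sum.cong)
  also have "\<dots> = y * \<psi> (replicate n l)"
    by (subst sum.swap) (simp add: sum.delta)
  finally show ?case .
next
  case (Suc k)
  then obtain m where m: "n = Suc m" by (cases n) auto
  show ?case using Suc by (simp add: m)
qed

section \<open>The weights of both models and their Yang-Baxter equations\<close>

definition spin1_weight :: "complex \<Rightarrow> complex \<Rightarrow> complex \<Rightarrow> (spin_half, spin_one) weight" where
  "spin1_weight q s z a t c w = R_entry q s z (c, w) (a, t)"

lemma spin1_weight_simps:
  "spin1_weight q s z Up UUp c w = (if c = Up \<and> w = UUp then br (q\<^sup>2 * z) else 0)"
  "spin1_weight q s z Up Zero c w =
    (if c = Up \<and> w = Zero then br (q * z) else if c = Down \<and> w = UUp then s else 0)"
  "spin1_weight q s z Up DDown c w =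
    (if c = Up \<and> w = DDown then br z else if c = Down \<and> w = Zero then s else 0)"
  "spin1_weight q s z Down UUp c w =
    (if c = Down \<and> w = UUp then br z else if c = Up \<and> w = Zero then s else 0)"
  "spin1_weight q s z Down Zero c w =
    (if c = Down \<and> w = Zero then br (q * z) else if c = Up \<and> w = DDown then s else 0)"
  "spin1_weight q s z Down DDown c w = (if c = Down \<and> w = DDown then br (q\<^sup>2 * z) else 0)"
  by (cases c; cases w; simp add: spin1_weight_def R_entry_def doubleton_eq_iff)+

text \<open>The six-vertex R-matrix with crossing parameter \<open>q\<close> on two auxiliary
  spaces, composed with the flip; hence \<open>br q\<close> is on the diagonal and
  \<open>br z\<close> off it.\<close>

definition aux_R :: "complex \<Rightarrow> complex \<Rightarrow> spin_half \<times> spin_half \<Rightarrow> spin_half \<times> spin_half \<Rightarrow> complex" where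
  "aux_R q z = (\<lambda>(a1, a2) (b1, b2).
     if a1 = a2 then if b1 = a1 \<and> b2 = a1 then br (q * z) else 0
     else if b1 = a1 \<and> b2 = a2 then br q else if b1 = a2 \<and> b2 = a1 then br z else 0)"

text \<open>Checked component by component. The net change of the site state fixes the parity of the
  number of factors \<open>s\<close>, so the root occurs squared or as a common factor, and rational
  identities in \<open>q\<close>, \<open>z1\<close>, \<open>z2\<close> remain.\<close>

lemma spin1_row_exchange:
  assumes "q \<noteq> 0" "z1 \<noteq> 0" "z2 \<noteq> 0" "s\<^sup>2 = br q * br (q\<^sup>2)"
  shows "(\<Sum>d\<in>UNIV. aux_R q (z2 / z1) a d * fuse (spin1_weight q s z1) (spin1_weight q s z2) d t c w) =
    (\<Sum>d\<in>UNIV. fuse (spin1_weight q s z2) (spin1_weight q s z1) a t d w * aux_R q (z2 / z1) d c)"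
proof -
  have s: "s * s = br q * br (q\<^sup>2)" and s': "\<And>x. s * (s * x) = br q * br (q\<^sup>2) * x"
    using assms(4) by (simp_all add: power2_eq_square flip: mult.assoc)
  obtain a1 a2 c1 c2 where ac: "a = (a1, a2)" "c = (c1, c2)" by fastforce
  show ?thesis
    unfolding ac sum_UNIV_pair fuse_def aux_R_def UNIV_spin_half UNIV_spin_one
    apply (cases a1; cases a2; cases c1; cases c2; cases t; cases w; simp add: spin1_weight_simps mult_ac s s')
    using assms(1-3) apply (simp_all add: br_def field_simps)
    by (simp_all add: algebra_simps eval_nat_numeral)
qed


text \<open>The nineteen-vertex \<open>R\<close>-matrix of Fateev and Zamolodchikov, composed with the flip.\<close>

definition site_R ::
  "complex \<Rightarrow> complex \<Rightarrow> spin_one \<Rightarrow> spin_one \<Rightarrow> spin_one \<Rightarrow> spin_one \<Rightarrow> complex" where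
  "site_R q z p r w w' =
    (if p = r \<and> p \<noteq> Zero then (if w = p \<and> w' = p then br (q * z) * br (q\<^sup>2 * z) else 0)
     else if p = Zero \<and> r = Zero then
       (if w = Zero \<and> w' = Zero then br (q * z) * br z + br q * br (q\<^sup>2)
        else if w \<noteq> Zero \<and> w' \<noteq> Zero \<and> w \<noteq> w' then br z * br (q\<^sup>2) else 0)
     else if p = Zero \<or> r = Zero then
       (if w = r \<and> w' = p then br (q * z) * br z
        else if w = p \<and> w' = r then br (q * z) * br (q\<^sup>2) else 0)
     else
       (if w = Zero \<and> w' = Zero then br z * br (q\<^sup>2)
        else if w = p \<and> w' = r then br q * br (q\<^sup>2)
        else if w = r \<and> w' = p then br z * br (z / q) else 0))"

text \<open>Again a check of all components; here the parity of the number of factors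
  \<open>s\<close> is fixed by whether \<open>a\<close> and \<open>b\<close> agree.\<close>

lemma spin1_site_exchange:
  assumes "q \<noteq> 0" "z1 \<noteq> 0" "z2 \<noteq> 0" "s\<^sup>2 = br q * br (q\<^sup>2)"
  shows "site_exchange (site_R q (z1 / z2)) (spin1_weight q s z1) (spin1_weight q s z2)"
  unfolding site_exchange_def
proof (intro allI)
  fix a b p r w w'
  have s: "s * s = br q * br (q\<^sup>2)" and s': "\<And>x. s * (s * x) = br q * br (q\<^sup>2) * x"
    using assms(4) by (simp_all add: power2_eq_square flip: mult.assoc)
  show "(\<Sum>c\<in>UNIV. \<Sum>t\<in>UNIV. \<Sum>t'\<in>UNIV. spin1_weight q s z1 a t c w * spin1_weight q s z2 c t' b w' *
          site_R q (z1 / z2) p r t t') =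
        (\<Sum>c\<in>UNIV. \<Sum>t\<in>UNIV. \<Sum>t'\<in>UNIV. site_R q (z1 / z2) t t' w w' * spin1_weight q s z2 a p c t *
          spin1_weight q s z1 c r b t')"
    unfolding UNIV_spin_half UNIV_spin_one
    apply (cases a; cases b; cases p; cases r; cases w; cases w'; simp add: spin1_weight_simps site_R_def mult_ac s s')
    using assms(1-3) apply (simp_all add: br_def field_simps)
    by (simp_all add: algebra_simps eval_nat_numeral)
qed

text \<open>The six-vertex model whose crossing parameter is \<open>q\<^sup>2\<close> instead of \<open>q\<close>. The sign of the second
  weight is such that the first two weights agree, and equal \<open>[q]\<close>, at \<open>z = q\<^sup>-\<^sup>1\<close>.\<close>

definition six_weight :: "complex \<Rightarrow> complex \<Rightarrow> (spin_half, spin_half) weight" where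
  "six_weight q z a t c w =
    (if c = a \<and> w = t then (if a = t then br (q\<^sup>2 * z) else br (inverse z))
     else if c = t \<and> w = a then br (q\<^sup>2) else 0)"

text \<open>Composed with the flip as well; the sign of \<open>- br z\<close> matches the sign
  chosen for the second weight of \<open>six_weight\<close>.\<close>

definition six_R ::
  "complex \<Rightarrow> complex \<Rightarrow> spin_half \<Rightarrow> spin_half \<Rightarrow> spin_half \<Rightarrow> spin_half \<Rightarrow> complex" where
  "six_R q z p r w w' =
    (if p = r then if w = p \<and> w' = p then br (q\<^sup>2 * z) else 0
     else if w = p \<and> w' = r then br (q\<^sup>2) else if w = r \<and> w' = p then - br z else 0)"

lemma six_site_exchange:
  assumes "q \<noteq> 0" "z1 \<noteq> 0" "z2 \<noteq> 0"
  shows "site_exchange (six_R q (z1 / z2)) (six_weight q z1) (six_weight q z2)"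
  unfolding site_exchange_def
proof (intro allI)
  fix a b p r w w'
  show "(\<Sum>c\<in>UNIV. \<Sum>t\<in>UNIV. \<Sum>t'\<in>UNIV. six_weight q z1 a t c w * six_weight q z2 c t' b w' *
          six_R q (z1 / z2) p r t t') =
        (\<Sum>c\<in>UNIV. \<Sum>t\<in>UNIV. \<Sum>t'\<in>UNIV. six_R q (z1 / z2) t t' w w' * six_weight q z2 a p c t *
          six_weight q z1 c r b t')"
    unfolding UNIV_spin_half
    apply (cases a; cases b; cases p; cases r; cases w; cases w'; simp add: six_weight_def six_R_def)
    using assms by (simp_all add: br_def field_simps)
qed

section \<open>Partition functions with domain-wall boundary\<close>

text \<open>Entering in \<open>Down\<close> and leaving in \<open>Up\<close> selects the operator B
  of the monodromy, here with one inhomogeneity \<open>v\<close> per column.\<close>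

definition vm_row :: "(complex \<Rightarrow> (spin_half, 'b::finite) weight) \<Rightarrow> complex list \<Rightarrow> complex \<Rightarrow>
    ('b list \<Rightarrow> complex) \<Rightarrow> 'b list \<Rightarrow> complex" where
  "vm_row L vs u = row_op (map (\<lambda>v. L (u / v)) vs) Down Up"

definition vm_rows :: "(complex \<Rightarrow> (spin_half, 'b::finite) weight) \<Rightarrow> complex list \<Rightarrow> complex list \<Rightarrow>
    ('b list \<Rightarrow> complex) \<Rightarrow> 'b list \<Rightarrow> complex" where
  "vm_rows L us vs = foldr (vm_row L vs) us"

lemma vm_rows_Nil [simp]: "vm_rows L [] vs \<psi> = \<psi>"
  and vm_rows_Cons: "vm_rows L (u # us) vs \<psi> = vm_row L vs u (vm_rows L us vs \<psi>)"
  by (simp_all add: vm_rows_def)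

definition delta_state :: "'b list \<Rightarrow> 'b list \<Rightarrow> complex" where
  "delta_state \<tau> = (\<lambda>\<sigma>. if \<sigma> = \<tau> then 1 else 0)"

text \<open>The head of \<open>us\<close> is the row that acts last. Each row lowers the total site
  spin by one, so spin-one columns call for twice as many rows as columns.\<close>

definition dwpf :: "'b::finite \<Rightarrow> 'b \<Rightarrow> (complex \<Rightarrow> (spin_half, 'b) weight) \<Rightarrow> complex list \<Rightarrow> complex list \<Rightarrow> complex" where
  "dwpf h l L us vs =
     vm_rows L us vs (delta_state (replicate (length vs) h)) (replicate (length vs) l)"

lemma vm_rows_cong:
  assumes "length \<sigma> = length vs" "\<And>\<tau>. length \<tau> = length vs \<Longrightarrow> \<psi> \<tau> = \<psi>' \<tau>"
  shows "vm_rows L us vs \<psi> \<sigma> = vm_rows L us vs \<psi>' \<sigma>"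
  using assms(1)
proof (induction us arbitrary: \<sigma>)
  case (Cons u us)
  then show ?case by (auto simp: vm_rows_Cons vm_row_def intro: row_op_cong)
qed (simp add: assms)

lemma vm_rows_scale: "vm_rows L us vs (\<lambda>\<tau>. k * \<psi> \<tau>) \<sigma> = k * vm_rows L us vs \<psi> \<sigma>"
proof (induction us arbitrary: \<sigma>)
  case (Cons u us)
  then have "vm_rows L us vs (\<lambda>\<tau>. k * \<psi> \<tau>) = (\<lambda>\<sigma>. k * vm_rows L us vs \<psi> \<sigma>)" by blast
  then show ?case by (simp add: vm_rows_Cons vm_row_def row_op_scale)
qed simp

lemma vm_rows_swap_op:
  assumes "\<And>u. u \<in> set us \<Longrightarrow> site_exchange Y (L (u / v)) (L (u / w))"
  shows "vm_rows L us (xs @ v # w # ys) (swap_op Y (length xs) \<psi>) =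
    swap_op Y (length xs) (vm_rows L us (xs @ w # v # ys) \<psi>)"
  using assms
proof (induction us)
  case (Cons u us)
  then have IH: "vm_rows L us (xs @ v # w # ys) (swap_op Y (length xs) \<psi>) =
    swap_op Y (length xs) (vm_rows L us (xs @ w # v # ys) \<psi>)" by simp
  show ?case
  proof
    fix \<sigma>
    show "vm_rows L (u # us) (xs @ v # w # ys) (swap_op Y (length xs) \<psi>) \<sigma> =
        swap_op Y (length xs) (vm_rows L (u # us) (xs @ w # v # ys) \<psi>) \<sigma>"
      using row_op_swap_op[of Y "L (u / v)" "L (u / w)" "map (\<lambda>v. L (u / v)) xs"
          "map (\<lambda>v. L (u / v)) ys" Down Up "vm_rows L us (xs @ w # v # ys) \<psi>" \<sigma>] Cons.prems[of u]
      by (simp add: vm_rows_Cons vm_row_def[abs_def] IH)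
  qed
qed simp

text \<open>The exchange matrix is inserted at the incoming reference state, where it is the scalar
  \<open>y\<close>, pulled through all rows, and removed at the outgoing state, where it is
  \<open>y\<close> again.\<close>

lemma dwpf_swap:
  assumes "\<And>u. u \<in> set us \<Longrightarrow> site_exchange Y (L (u / v)) (L (u / w))"
    and h: "\<And>s s'. Y h h s s' = (if s = h \<and> s' = h then y else 0)"
    and l: "\<And>p r. Y p r l l = (if p = l \<and> r = l then y else 0)" and "y \<noteq> 0"
  shows "dwpf h l L us (xs @ v # w # ys) = dwpf h l L us (xs @ w # v # ys)"
proof -
  let ?n = "length xs + (2 + length ys)"
  let ?\<psi> = "delta_state (replicate ?n h)"
  have "y * vm_rows L us (xs @ v # w # ys) ?\<psi> (replicate ?n l) =
    vm_rows L us (xs @ v # w # ys) (\<lambda>\<tau>. y * ?\<psi> \<tau>) (replicate ?n l)"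
    by (simp add: vm_rows_scale)
  also have "\<dots> = vm_rows L us (xs @ v # w # ys) (swap_op Y (length xs) ?\<psi>) (replicate ?n l)"
    by (intro vm_rows_cong swap_op_highest[where Y = Y and h = h and y = y and n = ?n and x = 1, OF h, symmetric]) (auto simp: delta_state_def)
  also have "\<dots> = swap_op Y (length xs) (vm_rows L us (xs @ w # v # ys) ?\<psi>) (replicate ?n l)"
    using assms(1) by (subst vm_rows_swap_op) auto
  also have "\<dots> = y * vm_rows L us (xs @ w # v # ys) ?\<psi> (replicate ?n l)"
    by (rule swap_op_lowest[where Y = Y and l = l and y = y, OF l]) simp
  finally show ?thesis using \<open>y \<noteq> 0\<close> by (simp add: dwpf_def)
qed

section \<open>Symmetry in the column and row parameters\<close>

lemma br_eq_0_iff: "z \<noteq> 0 \<Longrightarrow> br z = 0 \<longleftrightarrow> z\<^sup>2 = 1"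
  by (simp add: br_def field_simps power2_eq_square)

lemma br_inverse: "br (inverse z) = - br z"
  by (simp add: br_def)

text \<open>The pairs of column parameters at which the exchange matrices of both models are regular.\<close>

definition generic_pair :: "complex \<Rightarrow> complex \<Rightarrow> complex \<Rightarrow> bool" where
  "generic_pair q v w \<longleftrightarrow> v\<^sup>2 \<noteq> w\<^sup>2 \<and> q\<^sup>2 * v\<^sup>2 \<noteq> w\<^sup>2 \<and> q\<^sup>2 * w\<^sup>2 \<noteq> v\<^sup>2 \<and> q ^ 4 * v\<^sup>2 \<noteq> w\<^sup>2 \<and> q ^ 4 * w\<^sup>2 \<noteq> v\<^sup>2"

lemma generic_pair_br:
  assumes "generic_pair q v w" "q \<noteq> 0" "v \<noteq> 0" "w \<noteq> 0"
  shows "br (q * (w / v)) \<noteq> 0" "br (q\<^sup>2 * (w / v)) \<noteq> 0"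
  using assms by (auto simp: br_eq_0_iff generic_pair_def field_simps power_mult_distrib simp flip: power_mult)

lemma spin1_swap:
  assumes "generic_pair q v w" "q \<noteq> 0" "v \<noteq> 0" "w \<noteq> 0" "s\<^sup>2 = br q * br (q\<^sup>2)" "0 \<notin> set us"
  shows "dwpf UUp DDown (spin1_weight q s) us (xs @ v # w # ys) =
    dwpf UUp DDown (spin1_weight q s) us (xs @ w # v # ys)"
\<comment> \<open>The quotient of \<open>u / v\<close> and \<open>u / w\<close> is
  \<open>w / v\<close> for every \<open>u\<close>, so one exchange matrix serves all rows.\<close>
proof (rule dwpf_swap[where Y = "site_R q (w / v)" and y = "br (q * (w / v)) * br (q\<^sup>2 * (w / v))"])
  fix u assume "u \<in> set us"
  then have "u \<noteq> 0" using assms by auto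
  then show "site_exchange (site_R q (w / v)) (spin1_weight q s (u / v)) (spin1_weight q s (u / w))"
    using spin1_site_exchange[of q "u / v" "u / w" s] assms by simp
next
  fix p r show "site_R q (w / v) p r DDown DDown =
      (if p = DDown \<and> r = DDown then br (q * (w / v)) * br (q\<^sup>2 * (w / v)) else 0)"
    by (cases p; cases r) (auto simp: site_R_def)
qed (use generic_pair_br[OF assms(1-4)] in \<open>auto simp: site_R_def\<close>)

lemma six_swap:
  assumes "generic_pair q v w" "q \<noteq> 0" "v \<noteq> 0" "w \<noteq> 0" "0 \<notin> set us"
  shows "dwpf Up Down (six_weight q) us (xs @ v # w # ys) = dwpf Up Down (six_weight q) us (xs @ w # v # ys)"
proof (rule dwpf_swap[where Y = "six_R q (w / v)" and y = "br (q\<^sup>2 * (w / v))"])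
  fix u assume "u \<in> set us"
  then have "u \<noteq> 0" using assms by auto
  then show "site_exchange (six_R q (w / v)) (six_weight q (u / v)) (six_weight q (u / w))"
    using six_site_exchange[of q "u / v" "u / w"] assms by simp
next
  fix p r show "six_R q (w / v) p r Down Down =
      (if p = Down \<and> r = Down then br (q\<^sup>2 * (w / v)) else 0)"
    by (cases p; cases r) (auto simp: six_R_def)
qed (use generic_pair_br[OF assms(1-4)] in \<open>auto simp: six_R_def\<close>)

lemma dwpf_move:
  assumes "\<And>xs x ys. x \<in> A \<Longrightarrow> dwpf h l L us (xs @ x # v # ys) = dwpf h l L us (xs @ v # x # ys)"
    and "set xs \<subseteq> A"
  shows "dwpf h l L us (xs @ v # ys) = dwpf h l L us (v # xs @ ys)"
  using assms(2)
proof (induction xs arbitrary: ys rule: rev_induct)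
  case (snoc x xs)
  then show ?case using assms(1)[of x xs ys] snoc.IH[of "x # ys"] by simp
qed simp

text \<open>Commutation of two B operators is the entry of the exchange relation from
  \<open>(Down, Down)\<close> to \<open>(Up, Up)\<close>, where \<open>aux_R\<close> is the scalar
  \<open>br (q * (u2 / u1))\<close> on both sides.\<close>

lemma spin1_row_commute_aux:
  assumes "q \<noteq> 0" "u1 \<noteq> 0" "u2 \<noteq> 0" "0 \<notin> set vs" "s\<^sup>2 = br q * br (q\<^sup>2)" "br (q * (u2 / u1)) \<noteq> 0"
  shows "vm_row (spin1_weight q s) vs u1 (vm_row (spin1_weight q s) vs u2 \<psi>) =
    vm_row (spin1_weight q s) vs u2 (vm_row (spin1_weight q s) vs u1 \<psi>)"
proof
  fix \<sigma>
  let ?L = "spin1_weight q s" and ?X = "aux_R q (u2 / u1)"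
  let ?V = "map (\<lambda>v. fuse (?L (u1 / v)) (?L (u2 / v))) vs" and ?W = "map (\<lambda>v. fuse (?L (u2 / v)) (?L (u1 / v))) vs"
  have "(\<Sum>d\<in>UNIV. ?X a d * fuse (?L (u1 / v)) (?L (u2 / v)) d t c w) =
     (\<Sum>d\<in>UNIV. fuse (?L (u2 / v)) (?L (u1 / v)) a t d w * ?X d c)" if "v \<in> set vs" for v a t c w
  proof -
    have "v \<noteq> 0" using that assms by auto
    then show ?thesis using spin1_row_exchange[of q "u1 / v" "u2 / v" s a t c w] assms by simp
  qed
  then have "(\<Sum>d\<in>UNIV. ?X (Down, Down) d * row_op ?V d (Up, Up) \<psi> \<sigma>) =
      (\<Sum>d\<in>UNIV. row_op ?W (Down, Down) d \<psi> \<sigma> * ?X d (Up, Up))"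
    by (intro row_op_intertwine) (auto simp: list_all2_conv_all_nth)
  then have "br (q * (u2 / u1)) * row_op ?V (Down, Down) (Up, Up) \<psi> \<sigma> =
      br (q * (u2 / u1)) * row_op ?W (Down, Down) (Up, Up) \<psi> \<sigma>"
    by (simp add: sum_UNIV_pair UNIV_spin_half aux_R_def)
  then have "row_op ?V (Down, Down) (Up, Up) \<psi> \<sigma> = row_op ?W (Down, Down) (Up, Up) \<psi> \<sigma>"
    using assms(6) by simp
  then show "vm_row ?L vs u1 (vm_row ?L vs u2 \<psi>) \<sigma> = vm_row ?L vs u2 (vm_row ?L vs u1 \<psi>) \<sigma>"
    by (simp add: vm_row_def[abs_def] row_op_row_op[where \<psi> = \<psi>] zip_map_map o_def zip_same_conv_map)
qed

lemma spin1_row_commute: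
  assumes "q \<noteq> 0" "q ^ 4 \<noteq> 1" "u1 \<noteq> 0" "u2 \<noteq> 0" "0 \<notin> set vs" "s\<^sup>2 = br q * br (q\<^sup>2)"
  shows "vm_row (spin1_weight q s) vs u1 (vm_row (spin1_weight q s) vs u2 \<psi>) =
    vm_row (spin1_weight q s) vs u2 (vm_row (spin1_weight q s) vs u1 \<psi>)"
proof -
  \<comment> \<open>Both brackets vanish only if \<open>q ^ 4 = 1\<close>, so the previous lemma
    applies to the two rows in at least one order.\<close>
  have "br (q * (u2 / u1)) \<noteq> 0 \<or> br (q * (u1 / u2)) \<noteq> 0"
  proof (rule ccontr)
    assume "\<not> ?thesis"
    then have "q\<^sup>2 * u2\<^sup>2 = u1\<^sup>2" "q\<^sup>2 * u1\<^sup>2 = u2\<^sup>2"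
      using assms by (auto simp: br_eq_0_iff power_mult_distrib field_simps)
    then have "q ^ 4 * u1\<^sup>2 = u1\<^sup>2" by (simp add: power4_eq_xxxx power2_eq_square mult.assoc)
    then show False using assms by simp
  qed
  then show ?thesis using spin1_row_commute_aux[of q u1 u2 vs s \<psi>] spin1_row_commute_aux[of q u2 u1 vs s \<psi>] assms by metis
qed

lemma spin1_rows_permute:
  assumes "q \<noteq> 0" "q ^ 4 \<noteq> 1" "0 \<notin> set us" "0 \<notin> set vs" "s\<^sup>2 = br q * br (q\<^sup>2)" "mset us = mset us'"
  shows "vm_rows (spin1_weight q s) us vs = vm_rows (spin1_weight q s) us' vs"
proof -
  have "fold (vm_row (spin1_weight q s) vs) (rev us) = fold (vm_row (spin1_weight q s) vs) (rev us')"
  proof (rule fold_multiset_equiv)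
    fix x y assume "x \<in> set (rev us)" "y \<in> set (rev us)"
    then have "x \<noteq> 0" "y \<noteq> 0" using assms by auto
    then show "vm_row (spin1_weight q s) vs x \<circ> vm_row (spin1_weight q s) vs y =
        vm_row (spin1_weight q s) vs y \<circ> vm_row (spin1_weight q s) vs x"
      using spin1_row_commute[OF assms(1,2) _ _ assms(4,5)] by (auto simp: o_def)
  qed (simp add: assms)
  then show ?thesis by (simp add: vm_rows_def fun_eq_iff foldr_conv_fold)
qed

section \<open>Frozen rows and columns\<close>

text \<open>With \<open>Down\<close> entering and the outgoing site state given, spin conservation
  leaves at most two choices for the first vertex: keep the auxiliary state, or flip it and lower
  the site by one.\<close>

lemma spin1_row_UUp:
  "row_op (map (spin1_weight q s) (z # zs)) Down Up \<psi> (UUp # \<sigma>) =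
     br z * row_op (map (spin1_weight q s) zs) Down Up (\<lambda>\<tau>. \<psi> (UUp # \<tau>)) \<sigma>"
  and spin1_row_Zero:
  "row_op (map (spin1_weight q s) (z # zs)) Down Up \<psi> (Zero # \<sigma>) =
     br (q * z) * row_op (map (spin1_weight q s) zs) Down Up (\<lambda>\<tau>. \<psi> (Zero # \<tau>)) \<sigma>
     + s * row_op (map (spin1_weight q s) zs) Up Up (\<lambda>\<tau>. \<psi> (UUp # \<tau>)) \<sigma>"
  and spin1_row_DDown:
  "row_op (map (spin1_weight q s) (z # zs)) Down Up \<psi> (DDown # \<sigma>) =
     br (q\<^sup>2 * z) * row_op (map (spin1_weight q s) zs) Down Up (\<lambda>\<tau>. \<psi> (DDown # \<tau>)) \<sigma>
     + s * row_op (map (spin1_weight q s) zs) Up Up (\<lambda>\<tau>. \<psi> (Zero # \<tau>)) \<sigma>"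
  by (simp_all add: UNIV_spin_half UNIV_spin_one spin1_weight_simps)

text \<open>With \<open>Up\<close> entering and \<open>DDown\<close> leaving, spin conservation
  leaves only the diagonal vertex at each site.\<close>

lemma spin1_row_Up_DDown:
  "row_op (map (spin1_weight q s) zs) Up Up \<psi> (replicate (length zs) DDown) =
     prod_list (map br zs) * \<psi> (replicate (length zs) DDown)"
proof (induction zs arbitrary: \<psi>)
  case (Cons z zs)
  then show ?case by (simp add: UNIV_spin_half UNIV_spin_one spin1_weight_simps)
qed simp

text \<open>Since \<open>Down\<close> enters the first column, every row keeps or lowers its spin. A
  first column that ends in \<open>UUp\<close> is therefore constant and factors out.\<close>

lemma spin1_rows_UUp:
  "vm_rows (spin1_weight q s) us (v # vs) \<psi> (UUp # \<sigma>) =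
     (\<Prod>u\<leftarrow>us. br (u / v)) * vm_rows (spin1_weight q s) us vs (\<lambda>\<tau>. \<psi> (UUp # \<tau>)) \<sigma>"
proof (induction us arbitrary: \<sigma>)
  case (Cons u us)
  have "vm_rows (spin1_weight q s) (u # us) (v # vs) \<psi> (UUp # \<sigma>) =
     br (u / v) * vm_row (spin1_weight q s) vs u
       (\<lambda>\<tau>. (\<Prod>u\<leftarrow>us. br (u / v)) * vm_rows (spin1_weight q s) us vs (\<lambda>\<tau>. \<psi> (UUp # \<tau>)) \<tau>) \<sigma>"
    using spin1_row_UUp[of q s "u / v" "map (\<lambda>v. u / v) vs"]
    by (simp add: vm_rows_Cons vm_row_def Cons.IH o_def)
  then show ?case by (simp add: vm_row_def row_op_scale vm_rows_Cons)
qed simp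

lemma six_row_Up:
  "row_op (map (six_weight q) (z # zs)) Down Up \<psi> (Up # \<sigma>) =
     br (inverse z) * row_op (map (six_weight q) zs) Down Up (\<lambda>\<tau>. \<psi> (Up # \<tau>)) \<sigma>"
  and six_row_Down:
  "row_op (map (six_weight q) (z # zs)) Down Up \<psi> (Down # \<sigma>) =
     br (q\<^sup>2 * z) * row_op (map (six_weight q) zs) Down Up (\<lambda>\<tau>. \<psi> (Down # \<tau>)) \<sigma>
     + br (q\<^sup>2) * row_op (map (six_weight q) zs) Up Up (\<lambda>\<tau>. \<psi> (Up # \<tau>)) \<sigma>"
  by (simp_all add: UNIV_spin_half six_weight_def)

lemma six_row_Up_Down:
  "row_op (map (six_weight q) zs) Up Up \<psi> (replicate (length zs) Down) =
     (\<Prod>z\<leftarrow>zs. br (inverse z)) * \<psi> (replicate (length zs) Down)"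
proof (induction zs arbitrary: \<psi>)
  case (Cons z zs)
  then show ?case by (simp add: UNIV_spin_half six_weight_def)
qed simp

lemma six_rows_Up:
  "vm_rows (six_weight q) us (v # vs) \<psi> (Up # \<sigma>) =
     (\<Prod>u\<leftarrow>us. br (v / u)) * vm_rows (six_weight q) us vs (\<lambda>\<tau>. \<psi> (Up # \<tau>)) \<sigma>"
proof (induction us arbitrary: \<sigma>)
  case (Cons u us)
  have "vm_rows (six_weight q) (u # us) (v # vs) \<psi> (Up # \<sigma>) =
     br (v / u) * vm_row (six_weight q) vs u
       (\<lambda>\<tau>. (\<Prod>u\<leftarrow>us. br (v / u)) * vm_rows (six_weight q) us vs (\<lambda>\<tau>. \<psi> (Up # \<tau>)) \<tau>) \<sigma>"
    using six_row_Up[of q "u / v" "map (\<lambda>v. u / v) vs"]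
    by (simp add: vm_rows_Cons vm_row_def Cons.IH o_def)
  then show ?case by (simp add: vm_row_def row_op_scale vm_rows_Cons)
qed simp

lemma delta_state_Cons: "(\<lambda>\<tau>. delta_state (h # \<rho>) (h # \<tau>)) = delta_state \<rho>"
  by (simp add: delta_state_def fun_eq_iff)

lemma br_1 [simp]: "br 1 = 0"
  by (simp add: br_def)

text \<open>For \<open>u = v/q\<^sup>2\<close> and \<open>u = v/q\<close> the vertices \<open>(\<down>\<Down>)\<close> and \<open>(\<down>0)\<close> of the first column have weight
  zero, so the spin of that column is forced to go \<open>\<Up> \<rightarrow> 0 \<rightarrow> \<Down>\<close> in these two rows.\<close>

lemma spin1_dwpf_freeze:
  assumes "q \<noteq> 0" "v \<noteq> 0"
  shows "dwpf UUp DDown (spin1_weight q s) (v / q\<^sup>2 # v / q # us) (v # vs) =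
    s\<^sup>2 * (\<Prod>w\<leftarrow>vs. br (v / (q\<^sup>2 * w))) * (\<Prod>w\<leftarrow>vs. br (v / (q * w))) * (\<Prod>u\<leftarrow>us. br (u / v)) *
    dwpf UUp DDown (spin1_weight q s) us vs"
proof -
  let ?L = "spin1_weight q s" and ?n = "length vs"
  let ?d = "delta_state (replicate (Suc ?n) UUp)"
  have 1: "br (q\<^sup>2 * (v / q\<^sup>2 / v)) = 0" "br (q * (v / q / v)) = 0" using assms by simp_all
  have "vm_rows ?L (v / q\<^sup>2 # v / q # us) (v # vs) ?d (DDown # replicate ?n DDown) =
    s * (\<Prod>w\<leftarrow>vs. br (v / q\<^sup>2 / w)) * vm_rows ?L (v / q # us) (v # vs) ?d (Zero # replicate ?n DDown)"
    using 1 spin1_row_DDown[of q s "v / q\<^sup>2 / v" "map (\<lambda>w. v / q\<^sup>2 / w) vs"]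
      spin1_row_Up_DDown[of q s "map (\<lambda>w. v / q\<^sup>2 / w) vs"]
    by (simp add: vm_rows_Cons[of _ "v / q\<^sup>2"] vm_row_def o_def)
  also have "vm_rows ?L (v / q # us) (v # vs) ?d (Zero # replicate ?n DDown) =
    s * (\<Prod>w\<leftarrow>vs. br (v / q / w)) * vm_rows ?L us (v # vs) ?d (UUp # replicate ?n DDown)"
    using 1 spin1_row_Zero[of q s "v / q / v" "map (\<lambda>w. v / q / w) vs"]
      spin1_row_Up_DDown[of q s "map (\<lambda>w. v / q / w) vs"]
    by (simp add: vm_rows_Cons vm_row_def o_def)
  also have "vm_rows ?L us (v # vs) ?d (UUp # replicate ?n DDown) =
    (\<Prod>u\<leftarrow>us. br (u / v)) * dwpf UUp DDown ?L us vs"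
    by (simp add: spin1_rows_UUp dwpf_def delta_state_Cons)
  finally show ?thesis by (simp add: dwpf_def power2_eq_square mult_ac divide_simps)
qed

text \<open>At \<open>u = v / q\<^sup>2\<close> the vertex that keeps \<open>Down\<close> in the
  first column has weight zero. The column flips in this row, and the rest of the row and of the
  column is frozen.\<close>

lemma six_dwpf_freeze:
  assumes "q \<noteq> 0" "v \<noteq> 0"
  shows "dwpf Up Down (six_weight q) (v / q\<^sup>2 # us) (v # vs) =
    br (q\<^sup>2) * (\<Prod>w\<leftarrow>vs. br (inverse (v / (q\<^sup>2 * w)))) * (\<Prod>u\<leftarrow>us. br (v / u)) * dwpf Up Down (six_weight q) us vs"
proof -
  let ?L = "six_weight q" and ?n = "length vs"
  let ?d = "delta_state (replicate (Suc ?n) Up)"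
  have 1: "br (q\<^sup>2 * (v / q\<^sup>2 / v)) = 0" using assms by simp
  have "vm_rows ?L (v / q\<^sup>2 # us) (v # vs) ?d (Down # replicate ?n Down) =
    br (q\<^sup>2) * (\<Prod>w\<leftarrow>vs. br (inverse (v / q\<^sup>2 / w))) * vm_rows ?L us (v # vs) ?d (Up # replicate ?n Down)"
    using 1 six_row_Down[of q "v / q\<^sup>2 / v" "map (\<lambda>w. v / q\<^sup>2 / w) vs"]
      six_row_Up_Down[of q "map (\<lambda>w. v / q\<^sup>2 / w) vs"]
    by (simp add: vm_rows_Cons vm_row_def o_def)
  also have "vm_rows ?L us (v # vs) ?d (Up # replicate ?n Down) =
    (\<Prod>u\<leftarrow>us. br (v / u)) * dwpf Up Down ?L us vs"
    by (simp add: six_rows_Up dwpf_def delta_state_Cons)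
  finally show ?thesis by (simp add: dwpf_def mult_ac divide_simps)
qed

section \<open>Interpolation in a row parameter\<close>

text \<open>Vanishing coefficients instead of \<open>degree p < n\<close> make \<open>n = 0\<close>
  mean the zero function. The point \<open>u = 0\<close> is left out because the weights have poles
  there.\<close>

definition even_poly_fun :: "nat \<Rightarrow> (complex \<Rightarrow> complex) \<Rightarrow> bool" where
  "even_poly_fun n f \<longleftrightarrow> (\<exists>p. (\<forall>i\<ge>n. coeff p i = 0) \<and> (\<forall>u. u \<noteq> 0 \<longrightarrow> f u = poly p (u\<^sup>2)))"

lemma even_poly_fun_sum:
  assumes "\<And>i. i \<in> I \<Longrightarrow> even_poly_fun n (f i)"
  shows "even_poly_fun n (\<lambda>u. \<Sum>i\<in>I. f i u)"
proof -
  obtain p where "\<And>i. i \<in> I \<Longrightarrow> (\<forall>j\<ge>n. coeff (p i) j = 0) \<and> (\<forall>u. u \<noteq> 0 \<longrightarrow> f i u = poly (p i) (u\<^sup>2))"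
    using assms unfolding even_poly_fun_def by metis
  then show ?thesis unfolding even_poly_fun_def
    by (intro exI[of _ "\<Sum>i\<in>I. p i"]) (auto simp: coeff_sum poly_sum)
qed

lemma even_poly_fun_mult_linear:
  assumes "even_poly_fun n f"
  shows "even_poly_fun (Suc n) (\<lambda>u. (\<alpha> * u\<^sup>2 + \<beta>) * f u)"
proof -
  obtain p where p: "\<forall>i\<ge>n. coeff p i = 0" "\<forall>u. u \<noteq> 0 \<longrightarrow> f u = poly p (u\<^sup>2)"
    using assms by (auto simp: even_poly_fun_def)
  have "coeff ([:\<beta>, \<alpha>:] * p) i = 0" if "i \<ge> Suc n" for i
    using that p(1) by (cases i) auto
  then show ?thesis unfolding even_poly_fun_def using p(2)
    by (intro exI[of _ "[:\<beta>, \<alpha>:] * p"]) (auto simp: algebra_simps)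
qed

lemma even_poly_fun_cong:
  "even_poly_fun n f \<Longrightarrow> (\<And>u. u \<noteq> 0 \<Longrightarrow> g u = f u) \<Longrightarrow> even_poly_fun n g"
  by (auto simp: even_poly_fun_def)

lemma even_poly_fun_Suc: "even_poly_fun n f \<Longrightarrow> even_poly_fun (Suc n) f"
  unfolding even_poly_fun_def by (meson Suc_leD)

lemma even_poly_fun_scale:
  assumes "even_poly_fun n f"
  shows "even_poly_fun n (\<lambda>u. k * f u)"
proof -
  obtain p where p: "\<forall>i\<ge>n. coeff p i = 0" "\<forall>u. u \<noteq> 0 \<longrightarrow> f u = poly p (u\<^sup>2)"
    using assms by (auto simp: even_poly_fun_def)
  then show ?thesis unfolding even_poly_fun_def by (intro exI[of _ "smult k p"]) auto
qed

text \<open>The difference of the two polynomials has at least \<open>n\<close> roots and degree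
  below \<open>n\<close>. One square root of each node suffices, as both functions depend on
  \<open>u\<^sup>2\<close> only.\<close>

lemma even_poly_fun_unique:
  assumes "even_poly_fun n f" "even_poly_fun n g" "card S \<ge> n"
    and "\<And>z. z \<in> S \<Longrightarrow> \<exists>u. u \<noteq> 0 \<and> u\<^sup>2 = z \<and> f u = g u" and "u \<noteq> 0"
  shows "f u = g u"
proof -
  obtain p r where p: "\<forall>i\<ge>n. coeff p i = 0" "\<forall>u. u \<noteq> 0 \<longrightarrow> f u = poly p (u\<^sup>2)"
    and r: "\<forall>i\<ge>n. coeff r i = 0" "\<forall>u. u \<noteq> 0 \<longrightarrow> g u = poly r (u\<^sup>2)"
    using assms(1,2) by (auto simp: even_poly_fun_def)
  have "p - r = 0"
  proof (rule ccontr)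
    assume *: "p - r \<noteq> 0"
    have "coeff (p - r) (degree (p - r)) \<noteq> 0" using * leading_coeff_0_iff by blast
    then have "degree (p - r) < n" using p r by (metis coeff_diff diff_self not_le)
    moreover have "S \<subseteq> {x. poly (p - r) x = 0}"
      using assms(4) p(2) r(2) by auto (metis)
    then have "card S \<le> card {x. poly (p - r) x = 0}" by (intro card_mono poly_roots_finite *)
    moreover have "card {x. poly (p - r) x = 0} \<le> degree (p - r)" using * card_poly_roots_bound by blast
    ultimately show False using assms(3) by simp
  qed
  then show ?thesis using p r \<open>u \<noteq> 0\<close> by simp
qed

text \<open>Vertices that keep the auxiliary state have a part in \<open>z\<close> and one in
  \<open>1 / z\<close>, those that flip it are constant; this shape controls degree and parity in a
  row parameter.\<close>

definition trig_weight :: "(complex \<Rightarrow> ('a, 'b) weight) \<Rightarrow> bool" where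
  "trig_weight L \<longleftrightarrow> (\<forall>a t w. \<exists>\<alpha> \<beta>. \<forall>z. z \<noteq> 0 \<longrightarrow> L z a t a w = \<alpha> * z + \<beta> / z) \<and>
     (\<forall>a t c w. a \<noteq> c \<longrightarrow> (\<exists>k. \<forall>z. z \<noteq> 0 \<longrightarrow> L z a t c w = k))"

text \<open>The number of flips along N sites is even exactly if \<open>a = b\<close>, which fixes
  the parity of the powers of \<open>u\<close>. For \<open>a\<close> other than \<open>b\<close>
  there is at least one flip, so the powers run from -(N-1) to N-1 in steps of two: N coefficients.
  Writing \<open>u ^ length vs / u\<close> avoids a truncated exponent.\<close>

lemma row_op_even_poly_fun:
  fixes L :: "complex \<Rightarrow> (spin_half, 'b::finite) weight"
  assumes L: "trig_weight L" and "0 \<notin> set vs"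
  shows "even_poly_fun (if a = b then Suc (length vs) else length vs)
    (\<lambda>u. row_op (map (\<lambda>v. L (u / v)) vs) a b \<psi> \<sigma> * (if a = b then u ^ length vs else u ^ length vs / u))"
  using assms(2)
proof (induction vs arbitrary: a \<psi> \<sigma>)
  case Nil
  have "even_poly_fun (Suc 0) (\<lambda>u. \<psi> \<sigma>)" "even_poly_fun 0 (\<lambda>u. 0)"
    unfolding even_poly_fun_def by (intro exI[of _ "[:\<psi> \<sigma>:]"], auto simp: coeff_eq_0) (intro exI[of _ 0], auto)
  then show ?case by (auto elim: even_poly_fun_cong)
next
  case (Cons v vs)
  let ?n = "length vs"
  let ?R = "\<lambda>c t u. row_op (map (\<lambda>v. L (u / v)) vs) c b (\<lambda>\<tau>. \<psi> (t # \<tau>)) (tl \<sigma>)"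
  let ?f = "\<lambda>c u. if c = b then u ^ ?n else u ^ ?n / (u::complex)"
  let ?g = "\<lambda>u. if a = b then u ^ Suc ?n else u ^ Suc ?n / (u::complex)"
  let ?m = "if a = b then Suc (Suc ?n) else Suc ?n"
  have v: "v \<noteq> 0" using Cons.prems by auto
  have IH: "even_poly_fun (if c = b then Suc ?n else ?n) (\<lambda>u. ?R c t u * ?f c u)" for c t
    using Cons by simp
  have "even_poly_fun ?m (\<lambda>u. L (u / v) a t c (hd \<sigma>) * ?R c t u * ?g u)" for c t
  proof (cases "c = a")
    case True
    obtain \<alpha> \<beta> where ab: "\<And>z. z \<noteq> 0 \<Longrightarrow> L z a t a (hd \<sigma>) = \<alpha> * z + \<beta> / z"
      using L unfolding trig_weight_def by metis
    have ab': "L (u / v) a t a (hd \<sigma>) = (\<alpha> * u\<^sup>2 + \<beta> * v * v) / (u * v)" if "u \<noteq> 0" for u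
      using ab[of "u / v"] that v by (simp add: field_simps power2_eq_square)
    have "even_poly_fun ?m (\<lambda>u. (\<alpha> / v * u\<^sup>2 + \<beta> * v) * (?R a t u * ?f a u))"
      using even_poly_fun_mult_linear[OF IH[of a t], of "\<alpha> / v" "\<beta> * v"] by (cases "a = b") simp_all
    then show ?thesis unfolding True
      by (rule even_poly_fun_cong) (auto simp: ab' v field_simps power2_eq_square)
  next
    case False
    then obtain k where k: "\<And>z. z \<noteq> 0 \<Longrightarrow> L z a t c (hd \<sigma>) = k"
      using L unfolding trig_weight_def by metis
    show ?thesis
    proof (cases "a = b")
      case True
      have "even_poly_fun ?n (\<lambda>u. ?R c t u * (u ^ ?n / u))" using IH[of c t] False True by auto
      \<comment> \<open>With constant term \<open>0\<close> the linear factor supplies the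
        \<open>u\<^sup>2\<close> by which \<open>u ^ Suc ?n\<close> exceeds
        \<open>u ^ ?n / u\<close>.\<close>
      from even_poly_fun_mult_linear[OF this, of k 0] have "even_poly_fun ?m (\<lambda>u. (k * u\<^sup>2 + 0) * (?R c t u * (u ^ ?n / u)))"
        using True by (simp add: even_poly_fun_Suc)
      then show ?thesis
        by (rule even_poly_fun_cong) (use v k True in \<open>auto simp: field_simps power2_eq_square\<close>)
    next
      case nb: False
      then have "c = b" using False by (cases a; cases b; cases c) auto
      then have "even_poly_fun (Suc ?n) (\<lambda>u. ?R c t u * u ^ ?n)" using IH[of c t] by simp
      from even_poly_fun_scale[OF this, of k] have "even_poly_fun ?m (\<lambda>u. k * (?R c t u * u ^ ?n))" using nb by simp
      then show ?thesis
        by (rule even_poly_fun_cong) (use v k nb in \<open>auto simp: field_simps\<close>)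
    qed
  qed
  then have "even_poly_fun ?m (\<lambda>u. \<Sum>c\<in>UNIV. \<Sum>t\<in>UNIV. L (u / v) a t c (hd \<sigma>) * ?R c t u * ?g u)"
    by (intro even_poly_fun_sum)
  then show ?case
    by (auto elim!: even_poly_fun_cong simp: sum_distrib_right)
qed

lemma trig_weight_spin1: "trig_weight (spin1_weight q s)"
proof -
  have "\<exists>\<alpha> \<beta>. \<forall>z. z \<noteq> 0 \<longrightarrow> spin1_weight q s z a t a w = \<alpha> * z + \<beta> / z" for a t w
  proof -
    have "spin1_weight q s z a t a w = (if w = t then br ((if t = Zero then q else if (a = Up) = (t = UUp) then q\<^sup>2 else 1) * z) else 0)" for z
      by (cases a; cases t; cases w) (simp_all add: spin1_weight_simps)
    moreover have "\<exists>\<alpha> \<beta>. \<forall>z. z \<noteq> 0 \<longrightarrow> br (k * z) = \<alpha> * z + \<beta> / z" for k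
      by (intro exI[of _ k] exI[of _ "- inverse k"]) (simp add: br_def field_simps)
    moreover have "\<exists>\<alpha> \<beta>. \<forall>z. z \<noteq> 0 \<longrightarrow> (0::complex) = \<alpha> * z + \<beta> / z"
      by (intro exI[of _ 0]) simp
    ultimately show ?thesis by (cases "w = t") auto
  qed
  moreover have "\<exists>k. \<forall>z. z \<noteq> 0 \<longrightarrow> spin1_weight q s z a t c w = k" if "a \<noteq> c" for a t c w
    using that by (cases a; cases t; cases c) (auto simp: spin1_weight_simps)
  ultimately show ?thesis by (auto simp: trig_weight_def)
qed

lemma trig_weight_six: "trig_weight (six_weight q)"
proof -
  have "\<exists>\<alpha> \<beta>. \<forall>z. z \<noteq> 0 \<longrightarrow> six_weight q z a t a w = \<alpha> * z + \<beta> / z" for a t w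
  proof -
    have "\<exists>\<alpha> \<beta>. \<forall>z. z \<noteq> 0 \<longrightarrow> br (q\<^sup>2 * z) = \<alpha> * z + \<beta> / z"
      by (intro exI[of _ "q\<^sup>2"] exI[of _ "- inverse (q\<^sup>2)"]) (simp add: br_def field_simps)
    moreover have "\<exists>\<alpha> \<beta>. \<forall>z. z \<noteq> 0 \<longrightarrow> br (inverse z) = \<alpha> * z + \<beta> / z"
      by (intro exI[of _ "- 1"] exI[of _ 1]) (simp add: br_def field_simps)
    moreover have "\<exists>\<alpha> \<beta>. \<forall>z. z \<noteq> 0 \<longrightarrow> (0::complex) = \<alpha> * z + \<beta> / z"
      by (intro exI[of _ 0]) simp
    ultimately show ?thesis by (cases "w = t"; cases "a = t") (auto simp: six_weight_def)
  qed
  moreover have "\<exists>k. \<forall>z. z \<noteq> 0 \<longrightarrow> six_weight q z a t c w = k" if "a \<noteq> c" for a t c w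
    using that by (auto simp: six_weight_def)
  ultimately show ?thesis by (auto simp: trig_weight_def)
qed

lemma dwpf_even_poly_fun:
  assumes "trig_weight L" "0 \<notin> set vs"
  shows "even_poly_fun (length vs) (\<lambda>u. dwpf h l L (u # us) vs * (u ^ length vs / u))"
  using row_op_even_poly_fun[OF assms, of Down Up] by (simp add: dwpf_def vm_rows_Cons vm_row_def)

section \<open>Reduction of the spin-one to the six-vertex partition function\<close>

text \<open>The ratio of the two partition functions: one \<open>br q\<close> per column and a
  symmetric product of two brackets per pair of columns. It does not depend on the row parameters
  \<open>ws\<close>.\<close>

fun dw_factor :: "complex \<Rightarrow> complex list \<Rightarrow> complex" where
  "dw_factor q [] = 1"
| "dw_factor q (v # vs) = br q * (\<Prod>w\<leftarrow>vs. br (q * v / w) * br (q * w / v)) * dw_factor q vs"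

lemma dw_factor_move: "dw_factor q (xs @ v # ys) = dw_factor q (v # xs @ ys)"
proof (induction xs)
  case (Cons x xs)
  then show ?case by (simp add: mult_ac)
qed simp

lemma prod_list_neg: "(\<Prod>x\<leftarrow>xs. - f x :: complex) = (- 1) ^ length xs * (\<Prod>x\<leftarrow>xs. f x)"
  by (induction xs) auto

lemma prod_list_mult: "(\<Prod>x\<leftarrow>xs. f x * g x :: complex) = (\<Prod>x\<leftarrow>xs. f x) * (\<Prod>x\<leftarrow>xs. g x)"
  by (induction xs) auto

text \<open>By the two freezing formulas and \<open>s\<^sup>2 = br q * br (q\<^sup>2)\<close>, the
  ratio grows by exactly the factor that \<open>dw_factor\<close> gains from the column
  \<open>v\<close>. Inverting brackets costs the sign \<open>(- 1) ^ length vs\<close> four times,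
  which cancels.\<close>

lemma freeze_compare:
  assumes "q \<noteq> 0" "q ^ 4 \<noteq> 1" "v \<noteq> 0" "s\<^sup>2 = br q * br (q\<^sup>2)" "length ws = length vs"
    and "dwpf UUp DDown (spin1_weight q s) (ws @ map (\<lambda>w. w / q) vs) vs =
      dw_factor q vs * dwpf Up Down (six_weight q) ws vs"
  shows "dwpf UUp DDown (spin1_weight q s) (v / q\<^sup>2 # v / q # ws @ map (\<lambda>w. w / q) vs) (v # vs) =
    dw_factor q (v # vs) * dwpf Up Down (six_weight q) (v / q\<^sup>2 # ws) (v # vs)"
proof -
  have n1: "(\<Prod>u\<leftarrow>ws. br (u / v)) = (- 1) ^ length vs * (\<Prod>u\<leftarrow>ws. br (v / u))"
    using prod_list_neg[of "\<lambda>u. br (v / u)" ws] br_inverse[of "v / _"] assms(5) by simp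
  have n2: "(\<Prod>w\<leftarrow>vs. br (v / (q * w))) = (- 1) ^ length vs * (\<Prod>w\<leftarrow>vs. br (q * w / v))"
    using prod_list_neg[of "\<lambda>w. br (q * w / v)" vs] br_inverse[of "q * _ / v"] by simp
  have n3: "(\<Prod>w\<leftarrow>vs. br (w / (q * v))) = (- 1) ^ length vs * (\<Prod>w\<leftarrow>vs. br (q * v / w))"
    using prod_list_neg[of "\<lambda>w. br (q * v / w)" vs] br_inverse[of "q * v / _"] by simp
  have n4: "(\<Prod>w\<leftarrow>vs. br (v / (q\<^sup>2 * w))) = (- 1) ^ length vs * (\<Prod>w\<leftarrow>vs. br (inverse (v / (q\<^sup>2 * w))))"
    using prod_list_neg[of "\<lambda>w. br (inverse (v / (q\<^sup>2 * w)))" vs] by (simp only: br_inverse minus_minus)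
  have sg: "(- 1) ^ k * ((- 1) ^ k * x) = (x::complex)" for k x
    by (simp flip: power_add mult.assoc mult_2)
  show ?thesis
    unfolding spin1_dwpf_freeze[OF assms(1,3)] six_dwpf_freeze[OF assms(1,3)] map_append prod_list.append
      n4 n2 map_map o_def assms(4,6) n1
    using n3 by (simp add: prod_list_mult mult_ac sg)
qed

lemma generic_distinct:
  "sorted_wrt (generic_pair q) vs \<Longrightarrow> q \<noteq> 0 \<Longrightarrow> distinct (map (\<lambda>v. (v / q\<^sup>2)\<^sup>2) vs)"
  by (induction vs) (auto simp: generic_pair_def power_divide)

lemma spin1_dwpf_eq_six:
  assumes "q \<noteq> 0" "q ^ 4 \<noteq> 1" "s\<^sup>2 = br q * br (q\<^sup>2)"
    and "sorted_wrt (generic_pair q) vs" "0 \<notin> set vs" "0 \<notin> set ws" "length ws = length vs"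
  shows "dwpf UUp DDown (spin1_weight q s) (ws @ map (\<lambda>w. w / q) vs) vs =
    dw_factor q vs * dwpf Up Down (six_weight q) ws vs"
  using assms(4-)
proof (induction "length vs" arbitrary: vs ws)
  case 0
  then show ?case by (simp add: dwpf_def delta_state_def)
next
  case (Suc n)
  let ?F = "dwpf UUp DDown (spin1_weight q s)" and ?G = "dwpf Up Down (six_weight q)"
  \<comment> \<open>The power that turns both sides into polynomials in the square of the first row
    parameter.\<close>
  let ?h = "\<lambda>u::complex. u ^ length vs / u"
  from Suc obtain w ws' where ws: "ws = w # ws'" "length ws' = n" "w \<noteq> 0" "0 \<notin> set ws'"
    by (cases ws) auto
  have dist: "distinct (map (\<lambda>v. (v / q\<^sup>2)\<^sup>2) vs)"
    by (rule generic_distinct[OF Suc.prems(1) assms(1)])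
  have "?F (w # ws' @ map (\<lambda>w. w / q) vs) vs * ?h w = dw_factor q vs * (?G (w # ws') vs * ?h w)"
  proof (rule even_poly_fun_unique[where S = "set (map (\<lambda>v. (v / q\<^sup>2)\<^sup>2) vs)" and n = "length vs"
        and f = "\<lambda>u. ?F (u # ws' @ map (\<lambda>w. w / q) vs) vs * ?h u"
        and g = "\<lambda>u. dw_factor q vs * (?G (u # ws') vs * ?h u)"])
    show "even_poly_fun (length vs) (\<lambda>u. ?F (u # ws' @ map (\<lambda>w. w / q) vs) vs * ?h u)"
      using dwpf_even_poly_fun[OF trig_weight_spin1] Suc.prems by simp
    show "even_poly_fun (length vs) (\<lambda>u. dw_factor q vs * (?G (u # ws') vs * ?h u))"
      using dwpf_even_poly_fun[OF trig_weight_six] Suc.prems by (intro even_poly_fun_scale) simp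
    show "length vs \<le> card (set (map (\<lambda>v. (v / q\<^sup>2)\<^sup>2) vs))"
      using distinct_card[OF dist] by simp
    show "w \<noteq> 0" by fact
    fix z assume "z \<in> set (map (\<lambda>v. (v / q\<^sup>2)\<^sup>2) vs)"
    then obtain v where v: "v \<in> set vs" "z = (v / q\<^sup>2)\<^sup>2" by auto
    then obtain xs ys where vs: "vs = xs @ v # ys" by (meson split_list)
    have nz: "v \<noteq> 0" "0 \<notin> set xs" "0 \<notin> set ys" using Suc.prems vs by auto
    let ?u = "v / q\<^sup>2"
    have gen: "generic_pair q x v" if "x \<in> set xs" for x
      using that Suc.prems(1) by (auto simp: vs sorted_wrt_append)
    \<comment> \<open>The induction hypothesis is used for the columns without \<open>v\<close> and
      the rows without \<open>w\<close>.\<close>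
    have IH: "?F (ws' @ map (\<lambda>w. w / q) (xs @ ys)) (xs @ ys) = dw_factor q (xs @ ys) * ?G ws' (xs @ ys)"
      using Suc.prems Suc.hyps(2) ws vs by (intro Suc.hyps(1)) (auto simp: sorted_wrt_append)
    have F: "?F (?u # ws' @ map (\<lambda>w. w / q) vs) vs = ?F (?u # ws' @ map (\<lambda>w. w / q) vs) (v # xs @ ys)"
      unfolding vs using nz ws assms gen
      by (intro dwpf_move[where A = "set xs"] spin1_swap) auto
    \<comment> \<open>The row \<open>v / q\<close> occurs in
      \<open>map (\<lambda>w. w / q) vs\<close>; commuting rows brings it next to \<open>?u\<close>,
      as the freezing of column \<open>v\<close> takes these two rows.\<close>
    also have "\<dots> = ?F (?u # v / q # ws' @ map (\<lambda>w. w / q) (xs @ ys)) (v # xs @ ys)"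
      unfolding dwpf_def using nz ws assms vs
      by (subst spin1_rows_permute[where us' = "?u # v / q # ws' @ map (\<lambda>w. w / q) (xs @ ys)"]) auto
    also have "\<dots> = dw_factor q (v # xs @ ys) * ?G (?u # ws') (v # xs @ ys)"
      using freeze_compare[OF assms(1,2) nz(1) assms(3) _ IH] Suc.hyps(2) ws vs by simp
    also have "?G (?u # ws') (v # xs @ ys) = ?G (?u # ws') vs"
      unfolding vs using nz ws assms gen
      by (intro dwpf_move[where A = "set xs", symmetric] six_swap) auto
    also have "dw_factor q (v # xs @ ys) = dw_factor q vs"
      by (simp only: vs dw_factor_move)
    finally show "\<exists>u. u \<noteq> 0 \<and> u\<^sup>2 = z \<and>
        ?F (u # ws' @ map (\<lambda>w. w / q) vs) vs * ?h u = dw_factor q vs * (?G (u # ws') vs * ?h u)"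
      using v nz assms(1) by (intro exI[of _ ?u]) simp
  qed
  then show ?case using ws by simp
qed

section \<open>The homogeneous limit\<close>

text \<open>A row is a finite sum of products of weights. The index list \<open>ks\<close> stands in
  for the list of weights, so that each entry is a function of \<open>e\<close>.\<close>

lemma isCont_row_op:
  fixes \<psi> :: "real \<Rightarrow> 'b::finite list \<Rightarrow> complex" and W :: "'i \<Rightarrow> real \<Rightarrow> ('a::finite, 'b) weight"
  assumes "\<And>\<tau>. isCont (\<lambda>e. \<psi> e \<tau>) x"
    and "\<And>i a t c w. i \<in> set ks \<Longrightarrow> isCont (\<lambda>e. W i e a t c w) x"
  shows "isCont (\<lambda>e. row_op (map (\<lambda>i. W i e) ks) a b (\<psi> e) \<sigma>) x"
  using assms
proof (induction ks arbitrary: a \<psi> \<sigma>)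
  case (Cons i ks)
  show ?case using Cons.prems
    by (auto intro!: continuous_intros Cons.IH)
next
  case Nil
  then show ?case by (cases "a = b") simp_all
qed

lemma isCont_vm_rows:
  fixes U :: "'i \<Rightarrow> real \<Rightarrow> complex" and V :: "'j \<Rightarrow> real \<Rightarrow> complex"
  assumes L: "\<And>z a t c w. z \<noteq> 0 \<Longrightarrow> isCont (\<lambda>z. L z a t c w) z"
    and "\<And>i. i \<in> set ks \<Longrightarrow> isCont (U i) x \<and> U i x \<noteq> 0"
    and V: "\<And>j. j \<in> set js \<Longrightarrow> isCont (V j) x \<and> V j x \<noteq> 0"
  shows "isCont (\<lambda>e. vm_rows L (map (\<lambda>i. U i e) ks) (map (\<lambda>j. V j e) js) \<psi> \<sigma>) x"
  using assms(2)
proof (induction ks arbitrary: \<sigma>)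
  case (Cons i ks)
  have "isCont (\<lambda>e. row_op (map (\<lambda>j. L (U i e / V j e)) js) Down Up
      (vm_rows L (map (\<lambda>i. U i e) ks) (map (\<lambda>j. V j e) js) \<psi>) \<sigma>) x"
  proof (rule isCont_row_op)
    fix j a t c w assume "j \<in> set js"
    then have "isCont (\<lambda>e. U i e / V j e) x" "U i x / V j x \<noteq> 0"
      using V Cons.prems by (auto intro!: continuous_intros)
    then show "isCont (\<lambda>e. L (U i e / V j e) a t c w) x"
      using L by (intro isCont_o2[where g = "\<lambda>z. L z a t c w" and f = "\<lambda>e. U i e / V j e"])
  qed (use Cons in auto)
  then show ?case by (simp add: vm_rows_Cons vm_row_def o_def)
qed simp

lemma isCont_br: "z \<noteq> 0 \<Longrightarrow> isCont br z"
  unfolding br_def[abs_def] by (intro continuous_intros) auto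

lemma isCont_br_comp [continuous_intros]: "isCont f x \<Longrightarrow> f x \<noteq> 0 \<Longrightarrow> isCont (\<lambda>e. br (f e)) x"
  by (rule isCont_o2[where g = br]) (auto intro: isCont_br)

lemma isCont_spin1_weight: "q \<noteq> 0 \<Longrightarrow> z \<noteq> 0 \<Longrightarrow> isCont (\<lambda>z. spin1_weight q s z a t c w) z"
  by (cases a; cases t; cases c; cases w) (auto simp: spin1_weight_simps intro!: continuous_intros)

lemma isCont_six_weight: "q \<noteq> 0 \<Longrightarrow> z \<noteq> 0 \<Longrightarrow> isCont (\<lambda>z. six_weight q z a t c w) z"
  by (cases a; cases t; cases c; cases w) (auto simp: six_weight_def intro!: continuous_intros)

lemma isCont_dw_factor:
  fixes V :: "'j \<Rightarrow> real \<Rightarrow> complex"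
  assumes "\<And>j. j \<in> set js \<Longrightarrow> isCont (V j) x \<and> V j x \<noteq> 0" "q \<noteq> 0"
  shows "isCont (\<lambda>e. dw_factor q (map (\<lambda>j. V j e) js)) x"
  using assms(1)
proof (induction js)
  case (Cons j js)
  \<comment> \<open>The inner product runs over the tail with \<open>j\<close> fixed; allowing any
    \<open>ks\<close> with entries from \<open>js\<close> gives it an induction of its own.\<close>
  have "isCont (\<lambda>e. \<Prod>k\<leftarrow>ks. br (q * V j e / V k e) * br (q * V k e / V j e)) x" if "set ks \<subseteq> set js" for ks
    using that
  proof (induction ks)
    case (Cons k ks)
    then have "isCont (V j) x" "V j x \<noteq> 0" "isCont (V k) x" "V k x \<noteq> 0" using \<open>\<And>k. k \<in> set (j # js) \<Longrightarrow> _ k\<close> by auto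
    then show ?case using Cons \<open>q \<noteq> 0\<close> by (auto intro!: continuous_intros)
  qed simp
  then show ?case using Cons by (auto intro!: continuous_intros simp: o_def)
qed simp

lemma dw_factor_replicate: "dw_factor q (replicate n 1) = br q ^ (n\<^sup>2)"
proof (induction n)
  case (Suc n)
  have "(Suc n)\<^sup>2 = 1 + (n + n) + n\<^sup>2" by (simp add: power2_eq_square)
  then show ?case using Suc by (simp add: map_replicate_const power_add power_mult_distrib mult_ac)
qed simp

text \<open>The conditions with \<open>q\<^sup>2\<close> and \<open>q ^ 4\<close> hold near
  \<open>e = 0\<close> because they hold in the limit, where all points are 1. The squares of the
  points differ for \<open>e > 0\<close>, when the points are positive and increasing; hence the
  one-sided filter.\<close>

lemma eventually_generic:
  fixes q :: complex
  assumes "q\<^sup>2 \<noteq> 1" "q ^ 4 \<noteq> 1"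
  shows "\<forall>\<^sub>F e in at_right (0::real). sorted_wrt (generic_pair q) (map (\<lambda>j. of_real (1 + real j * e)) [0..<n])"
proof -
  have ev: "\<forall>\<^sub>F e in at_right (0::real). k * (of_real (1 + real i * e))\<^sup>2 \<noteq> (of_real (1 + real j * e))\<^sup>2"
    if "k \<noteq> 1" for i j and k :: complex
  proof -
    have "((\<lambda>e. k * (of_real (1 + real i * e))\<^sup>2 - (of_real (1 + real j * e))\<^sup>2) \<longlongrightarrow> k * (of_real (1 + real i * 0))\<^sup>2 - (of_real (1 + real j * 0))\<^sup>2) (at_right (0::real))"
      by (intro tendsto_intros)
    then have "\<forall>\<^sub>F e in at_right (0::real). k * (of_real (1 + real i * e))\<^sup>2 - (of_real (1 + real j * e))\<^sup>2 \<noteq> 0"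
      by (rule tendsto_imp_eventually_ne) (use that in simp)
    then show ?thesis by eventually_elim auto
  qed
  have "\<forall>\<^sub>F e in at_right (0::real). \<forall>i\<in>{..<n}. \<forall>j\<in>{..<n}.
      q\<^sup>2 * (of_real (1 + real i * e))\<^sup>2 \<noteq> (of_real (1 + real j * e))\<^sup>2 \<and>
      q ^ 4 * (of_real (1 + real i * e))\<^sup>2 \<noteq> (of_real (1 + real j * e))\<^sup>2"
    using ev assms by (intro eventually_ball_finite ballI eventually_conj) auto
  moreover have "\<forall>\<^sub>F e in at_right (0::real). e > 0"
    by (simp add: eventually_at_right_less)
  ultimately show ?thesis
  proof eventually_elim
    case (elim e)
    have "(of_real (1 + real i * e))\<^sup>2 \<noteq> ((of_real (1 + real j * e))\<^sup>2 :: complex)" if "i < j" for i j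
    proof -
      have "0 < 1 + real i * e" "1 + real i * e < 1 + real j * e" using that elim by (simp_all add: add_pos_nonneg)
      then have "(1 + real i * e)\<^sup>2 \<noteq> (1 + real j * e)\<^sup>2" by (metis less_irrefl less_trans neg_less_0_iff_less power2_eq_iff)
      then show ?thesis by (metis of_real_eq_iff of_real_power)
    qed
    then show ?case using elim
      by (auto simp: sorted_wrt_iff_nth_less generic_pair_def)
  qed
qed

lemma spin1_dwpf_homogeneous:
  assumes "q \<noteq> 0" "q ^ 4 \<noteq> 1" "s\<^sup>2 = br q * br (q\<^sup>2)"
  shows "dwpf UUp DDown (spin1_weight q s) (replicate (2 * n) (inverse q)) (replicate n 1) =
    br q ^ (n\<^sup>2) * dwpf Up Down (six_weight q) (replicate n (inverse q)) (replicate n 1)"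
proof -
  define V where "V j e = complex_of_real (1 + real j * e)" for j e
  \<comment> \<open>\<open>Inl\<close> marks the rows that keep the parameter
    \<open>inverse q\<close>, \<open>Inr j\<close> the row tied to column \<open>j\<close>. At
    \<open>e = 0\<close> all \<open>2 * n\<close> rows have parameter
    \<open>inverse q\<close>.\<close>
  define U where "U x e = (case x of Inl _ \<Rightarrow> inverse q | Inr j \<Rightarrow> V j e / q)" for x :: "unit + nat" and e
  define xs where "xs = replicate n (Inl ()) @ map Inr [0..<n]"
  let ?vs = "\<lambda>e. map (\<lambda>j. V j e) [0..<n]" and ?ws = "replicate n (inverse q)"
  let ?F = "dwpf UUp DDown (spin1_weight q s)" and ?G = "dwpf Up Down (six_weight q)"
  have V: "isCont (V j) 0 \<and> V j 0 \<noteq> 0" for j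
    unfolding V_def by (auto intro!: continuous_intros)
  have U: "isCont (U x) 0 \<and> U x 0 \<noteq> 0" for x
    using V \<open>q \<noteq> 0\<close> by (cases x) (auto simp: U_def[abs_def] intro!: continuous_intros)
  have xs: "map (\<lambda>x. U x e) xs = ?ws @ map (\<lambda>w. w / q) (?vs e)" for e
    by (simp add: xs_def U_def o_def)
  have "isCont (\<lambda>e. ?F (?ws @ map (\<lambda>w. w / q) (?vs e)) (?vs e)) 0"
    using isCont_vm_rows[where L = "spin1_weight q s" and ks = xs and U = U and x = 0 and js = "[0..<n]" and V = V] isCont_spin1_weight \<open>q \<noteq> 0\<close> U V
    by (simp add: dwpf_def xs)
  then have F: "((\<lambda>e. ?F (?ws @ map (\<lambda>w. w / q) (?vs e)) (?vs e)) \<longlongrightarrow> ?F (?ws @ map (\<lambda>w. w / q) (?vs 0)) (?vs 0)) (at_right 0)"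
    by (simp add: isCont_def filterlim_at_split)
  have "isCont (\<lambda>e. dw_factor q (?vs e) * ?G ?ws (?vs e)) 0"
    using isCont_vm_rows[where L = "six_weight q" and ks = "replicate n (Inl ())" and U = U and x = 0 and js = "[0..<n]" and V = V] isCont_six_weight \<open>q \<noteq> 0\<close> U V
    by (auto simp: dwpf_def U_def intro!: continuous_intros isCont_dw_factor)
  then have G: "((\<lambda>e. dw_factor q (?vs e) * ?G ?ws (?vs e)) \<longlongrightarrow> dw_factor q (?vs 0) * ?G ?ws (?vs 0)) (at_right 0)"
    by (simp add: isCont_def filterlim_at_split)
  have FG: "\<forall>\<^sub>F e in at_right 0. ?F (?ws @ map (\<lambda>w. w / q) (?vs e)) (?vs e) = dw_factor q (?vs e) * ?G ?ws (?vs e)"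
  proof -
    have "q\<^sup>2 \<noteq> 1" using assms(2) by (metis one_power2 power2_eq_square power4_eq_xxxx mult.assoc)
    from eventually_generic[OF this assms(2), of n] eventually_at_right_less[of 0] show ?thesis
    proof eventually_elim
      case (elim e)
      have "V j e \<noteq> 0" for j
      proof -
        have "1 + real j * e > 0" using elim by (auto simp: add_pos_nonneg)
        then show ?thesis by (simp add: V_def del: of_real_add)
      qed
      then show ?case using elim assms by (intro spin1_dwpf_eq_six) (auto simp: V_def)
    qed
  qed
  have "?F (?ws @ map (\<lambda>w. w / q) (?vs 0)) (?vs 0) = dw_factor q (?vs 0) * ?G ?ws (?vs 0)"
    using F G unfolding tendsto_cong[OF FG] by (rule tendsto_unique[OF trivial_limit_at_right_real])
  moreover have "?vs 0 = replicate n 1" by (simp add: V_def map_replicate_const)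
  ultimately show ?thesis
    by (simp add: dw_factor_replicate mult_2 replicate_add divide_inverse)
qed

section \<open>Components of the iterated monodromy entry\<close>

text \<open>The first \<open>k\<close> sites form a row; the other sites are spectators, carried
  along as the fixed suffix \<open>drop k \<sigma>\<close>.\<close>

lemma monodromy_row_op:
  assumes "k \<le> length \<sigma>"
  shows "monodromy q s z k (\<lambda>a \<sigma>. if a = a0 then \<psi> \<sigma> else 0) b \<sigma> =
    row_op (replicate k (spin1_weight q s (inverse q * z))) a0 b (\<lambda>\<tau>. \<psi> (\<tau> @ drop k \<sigma>)) (take k \<sigma>)"
  using assms
proof (induction k arbitrary: b \<sigma>)
  case (Suc k)
  let ?W = "spin1_weight q s (inverse q * z)"
  have 1: "butlast (take (Suc k) \<sigma>) = take k \<sigma>" "last (take (Suc k) \<sigma>) = \<sigma> ! k"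
    using Suc.prems by (simp_all add: butlast_take take_Suc_conv_app_nth)
  have 2: "drop k (\<sigma>[k := t]) = t # drop (Suc k) \<sigma>" for t
    using Suc.prems by (simp add: drop_update_swap Cons_nth_drop_Suc[symmetric])
  have "monodromy q s z (Suc k) (\<lambda>a \<sigma>. if a = a0 then \<psi> \<sigma> else 0) b \<sigma> =
    (\<Sum>a\<in>UNIV. \<Sum>t\<in>UNIV. ?W a t b (\<sigma> ! k) *
      row_op (replicate k ?W) a0 a (\<lambda>\<tau>. \<psi> (\<tau> @ t # drop (Suc k) \<sigma>)) (take k \<sigma>))"
    unfolding UNIV_spin_half UNIV_spin_one using Suc
    by (simp add: R_site_def Suc.IH 2 flip: spin1_weight_def)
  also have "\<dots> = row_op (replicate k ?W @ [?W]) a0 b (\<lambda>\<tau>. \<psi> (\<tau> @ drop (Suc k) \<sigma>)) (take (Suc k) \<sigma>)"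
    using Suc.prems by (subst row_op_snoc) (simp_all add: 1)
  finally show ?case by (simp add: replicate_append_same)
qed simp

lemma B_op_eq_vm_row:
  "B_op q s 1 (length \<sigma>) \<psi> \<sigma> = vm_row (spin1_weight q s) (replicate (length \<sigma>) 1) (inverse q) \<psi> \<sigma>"
  using monodromy_row_op[of "length \<sigma>" \<sigma> q s 1 Down \<psi> Up] by (simp add: B_op_def vm_row_def)

lemma B_op_power_eq_vm_rows:
  assumes "length \<sigma> = N"
  shows "(B_op q s 1 N ^^ k) \<psi> \<sigma> = vm_rows (spin1_weight q s) (replicate k (inverse q)) (replicate N 1) \<psi> \<sigma>"
  using assms
proof (induction k arbitrary: \<sigma>)
  case (Suc k)
  have "(B_op q s 1 N ^^ Suc k) \<psi> \<sigma> = vm_row (spin1_weight q s) (replicate N 1) (inverse q) ((B_op q s 1 N ^^ k) \<psi>) \<sigma>"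
    using B_op_eq_vm_row[of q s \<sigma>] Suc.prems by simp
  also have "\<dots> = vm_row (spin1_weight q s) (replicate N 1) (inverse q)
      (vm_rows (spin1_weight q s) (replicate k (inverse q)) (replicate N 1) \<psi>) \<sigma>"
    unfolding vm_row_def using Suc by (intro row_op_cong) auto
  finally show ?case by (simp add: vm_rows_Cons)
qed simp

lemma spin1_rows_UUp_block:
  "vm_rows (spin1_weight q s) us (replicate (k + m) 1) (delta_state (replicate (k + m) UUp)) (replicate k UUp @ \<rho>) =
    prod_list (map br us) ^ k * vm_rows (spin1_weight q s) us (replicate m 1) (delta_state (replicate m UUp)) \<rho>"
  by (induction k) (simp_all add: spin1_rows_UUp delta_state_Cons)

text \<open>Each column that ends in \<open>UUp\<close> is frozen and gives
  \<open>br (inverse q) = - br q\<close> per row. The total exponent is even, so the sign drops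
  out.\<close>

lemma even_component:
  "(B_op q s 1 (2 * n) ^^ (2 * n)) (basis_state (replicate (2 * n) UUp)) (replicate n UUp @ replicate n DDown) =
    br q ^ (2 * n * n) * dwpf UUp DDown (spin1_weight q s) (replicate (2 * n) (inverse q)) (replicate n 1)"
  using spin1_rows_UUp_block[of q s "replicate (2 * n) (inverse q)" n n "replicate n DDown"]
  by (simp add: B_op_power_eq_vm_rows dwpf_def basis_state_def delta_state_def mult_2[symmetric]
      br_inverse power_mult[symmetric] power_mult_distrib[symmetric])

text \<open>The vertex that keeps \<open>Zero\<close> in the middle column has weight
  \<open>br (q * inverse q) = 0\<close>, so the last-acting row takes this column from
  \<open>UUp\<close> to \<open>Zero\<close> with weight \<open>s\<close>. Frozen vertices:
  \<open>n * (2 * n + 1)\<close> in the first columns, \<open>n\<close> in that row,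
  \<open>2 * n\<close> in the middle column.\<close>

lemma odd_component:
  assumes "q \<noteq> 0"
  shows "(B_op q s 1 (2 * n + 1) ^^ (2 * n + 1)) (basis_state (replicate (2 * n + 1) UUp))
      (replicate n UUp @ [Zero] @ replicate n DDown) =
    s * br q ^ (2 * n * n + 4 * n) *
      dwpf UUp DDown (spin1_weight q s) (replicate (2 * n) (inverse q)) (replicate n 1)"
proof -
  let ?L = "spin1_weight q s" and ?b = "br (inverse q)"
  let ?F = "dwpf UUp DDown ?L (replicate (2 * n) (inverse q)) (replicate n 1)"
  let ?d = "delta_state (replicate (Suc n) UUp)"
  have "vm_rows ?L (replicate (2 * n) (inverse q)) (1 # replicate n 1) ?d (UUp # replicate n DDown) = ?b ^ (2 * n) * ?F"
    by (simp add: spin1_rows_UUp delta_state_Cons dwpf_def)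
  then have "vm_rows ?L (replicate (Suc (2 * n)) (inverse q)) (1 # replicate n 1) ?d (Zero # replicate n DDown) =
    s * ?b ^ n * (?b ^ (2 * n) * ?F)"
    using spin1_row_Zero[of q s "inverse q" "replicate n (inverse q)"]
      spin1_row_Up_DDown[of q s "replicate n (inverse q)"] assms
    by (simp add: vm_rows_Cons vm_row_def)
  then have "(B_op q s 1 (2 * n + 1) ^^ (2 * n + 1)) (basis_state (replicate (2 * n + 1) UUp))
      (replicate n UUp @ [Zero] @ replicate n DDown) =
    (?b ^ Suc (2 * n)) ^ n * (s * ?b ^ n * (?b ^ (2 * n) * ?F))"
    using spin1_rows_UUp_block[of q s "replicate (Suc (2 * n)) (inverse q)" n "Suc n" "Zero # replicate n DDown"]
    by (subst B_op_power_eq_vm_rows) (simp_all add: basis_state_def delta_state_def mult_2)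
  also have "\<dots> = s * ?b ^ (2 * n * n + 4 * n) * ?F"
  proof -
    have "2 * n * n + 4 * n = Suc (2 * n) * n + n + 2 * n" by simp
    then have "?b ^ (2 * n * n + 4 * n) = (?b ^ Suc (2 * n)) ^ n * ?b ^ n * ?b ^ (2 * n)"
      by (simp only: power_add power_mult)
    then show ?thesis by (simp only: mult_ac)
  qed
  also have "?b ^ (2 * n * n + 4 * n) = br q ^ (2 * n * n + 4 * n)"
    by (simp add: br_inverse)
  finally show ?thesis .
qed

section \<open>Alternating sign matrices as six-vertex configurations\<close>

definition prefix_sums_01 :: "nat \<Rightarrow> (nat \<Rightarrow> int) \<Rightarrow> bool" where
  "prefix_sums_01 n f \<longleftrightarrow> (\<forall>j\<le>n. (\<Sum>l<j. f l) \<in> {0, 1}) \<and> (\<Sum>l<n. f l) = 1"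

definition alternating_fun :: "nat \<Rightarrow> (nat \<Rightarrow> int) \<Rightarrow> bool" where
  "alternating_fun n f \<longleftrightarrow> (\<forall>j k. j < k \<and> k < n \<and> f j \<noteq> 0 \<and> f k \<noteq> 0 \<and>
     (\<forall>l. j < l \<and> l < k \<longrightarrow> f l = 0) \<longrightarrow> sgn (f k) = - sgn (f j))"

lemma sum_lessThan_gap:
  fixes f :: "nat \<Rightarrow> int"
  assumes "j < k" "\<forall>l. j < l \<and> l < k \<longrightarrow> f l = 0"
  shows "(\<Sum>l<k. f l) = (\<Sum>l<Suc j. f l)"
  using assms by (intro sum.mono_neutral_right) auto

lemma prefix_sums_01_imp_alternating:
  assumes "prefix_sums_01 n f"
  shows "\<forall>l<n. f l \<in> {-1, 0, 1}" "alternating_fun n f"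
proof -
  have P: "(\<Sum>l<j. f l) = 0 \<or> (\<Sum>l<j. f l) = 1" if "j \<le> n" for j
    using assms that by (auto simp: prefix_sums_01_def)
  show "\<forall>l<n. f l \<in> {-1, 0, 1}"
  proof (intro allI impI)
    fix l assume "l < n"
    then show "f l \<in> {-1, 0, 1}" using P[of l] P[of "Suc l"] by auto
  qed
  show "alternating_fun n f"
    unfolding alternating_fun_def
  proof (intro allI impI, elim conjE)
    fix j k assume jk: "j < k" "k < n" "f j \<noteq> 0" "f k \<noteq> 0" "\<forall>l. j < l \<and> l < k \<longrightarrow> f l = 0"
    then have "(\<Sum>l<k. f l) = (\<Sum>l<Suc j. f l)" by (intro sum_lessThan_gap) auto
    then show "sgn (f k) = - sgn (f j)"
      using P[of j] P[of "Suc j"] P[of k] P[of "Suc k"] jk by auto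
  qed
qed

text \<open>Here \<open>e\<close> is the first non-zero entry and the inner \<open>i\<close> the
  last non-zero position before \<open>j\<close>. Tracking \<open>f i\<close> ties the current
  partial sum to the sign of the next non-zero entry.\<close>

lemma alternating_imp_prefix_sums:
  assumes "\<forall>l<n. f l \<in> {-1, 0, 1}" "alternating_fun n f" "j \<le> n"
  shows "(\<forall>l<j. f l = 0) \<or> (\<exists>e\<in>{-1, 1}. (\<forall>i\<le>j. (\<Sum>l<i. f l) \<in> {0, e}) \<and>
    (\<exists>i<j. (\<forall>l. i < l \<and> l < j \<longrightarrow> f l = 0) \<and> (f i = e \<and> (\<Sum>l<j. f l) = e \<or> f i = - e \<and> (\<Sum>l<j. f l) = 0)))"
  using assms(3)
proof (induction j)
  case (Suc j)
  then have fj: "f j \<in> {-1, 0, 1}" using assms(1) by auto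
  from Suc have "j \<le> n" by simp
  from Suc.IH[OF this] consider (zero) "\<forall>l<j. f l = 0"
    | (nonzero) e i where "e \<in> {-1, 1}" "\<forall>i\<le>j. (\<Sum>l<i. f l) \<in> {0, e}" "i < j"
        "\<forall>l. i < l \<and> l < j \<longrightarrow> f l = 0"
        "f i = e \<and> (\<Sum>l<j. f l) = e \<or> f i = - e \<and> (\<Sum>l<j. f l) = 0"
    by blast
  then show ?case
  proof cases
    case z: zero
    show ?thesis
    proof (cases "f j = 0")
      case True
      then show ?thesis using z by (auto simp: less_Suc_eq)
    next
      case False
      have "(\<Sum>l<i. f l) = 0" if "i \<le> j" for i using z that by (intro sum.neutral) auto
      then have "\<forall>i\<le>Suc j. (\<Sum>l<i. f l) \<in> {0, f j}" "(\<Sum>l<Suc j. f l) = f j" by (auto simp: le_Suc_eq)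
      then show ?thesis using False fj
        by (intro disjI2 bexI[of _ "f j"] conjI[OF _ exI[of _ j]]) auto
    qed
  next
    case nonzero
    note e = nonzero(1) and P = nonzero(2) and i = nonzero(3,4) and c = nonzero(5)
    show ?thesis
    proof (cases "f j = 0")
      case True
      then show ?thesis using e P i c
        by (intro disjI2 bexI[of _ e] conjI[OF _ exI[of _ i]]) (auto simp: le_Suc_eq less_Suc_eq)
    next
      case False
      have "f i \<noteq> 0" using c e by auto
      then have "sgn (f j) = - sgn (f i)"
        using assms(2) i False Suc.prems unfolding alternating_fun_def by auto
      then have "f j = - f i" using fj c e False by (auto split: if_splits)
      then have "f j = e \<and> (\<Sum>l<Suc j. f l) = e \<or> f j = - e \<and> (\<Sum>l<Suc j. f l) = 0" using c by auto
      then show ?thesis using e P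
        by (intro disjI2 bexI[of _ e] conjI[OF _ exI[of _ j]]) (auto simp: le_Suc_eq)
    qed
  qed
qed simp

text \<open>Alternation confines the partial sums to 0 and one sign \<open>e\<close>; the total 1
  selects \<open>e = 1\<close>.\<close>

lemma prefix_sums_01_iff:
  "prefix_sums_01 n f \<longleftrightarrow> (\<forall>l<n. f l \<in> {-1, 0, 1}) \<and> (\<Sum>l<n. f l) = 1 \<and> alternating_fun n f"
proof
  assume "prefix_sums_01 n f"
  then show "(\<forall>l<n. f l \<in> {-1, 0, 1}) \<and> (\<Sum>l<n. f l) = 1 \<and> alternating_fun n f"
    using prefix_sums_01_imp_alternating by (auto simp: prefix_sums_01_def)
next
  assume *: "(\<forall>l<n. f l \<in> {-1, 0, 1}) \<and> (\<Sum>l<n. f l) = 1 \<and> alternating_fun n f"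
  then have "\<not> (\<forall>l<n. f l = 0)" by (metis lessThan_iff sum.neutral zero_neq_one)
  then obtain e where e: "\<And>i. i \<le> n \<Longrightarrow> (\<Sum>l<i. f l) \<in> {0, e}"
    using alternating_imp_prefix_sums[of n f n] * by blast
  have "e = 1" using e[of n] * by simp
  then show "prefix_sums_01 n f" using e * unfolding prefix_sums_01_def by blast
qed

lemma alternating_fun_cong:
  assumes "\<And>l. l < n \<Longrightarrow> f l = g l" "alternating_fun n f"
  shows "alternating_fun n g"
  unfolding alternating_fun_def
proof (intro allI impI, elim conjE)
  fix j k assume jk: "j < k" "k < n" "g j \<noteq> 0" "g k \<noteq> 0" and g: "\<forall>l. j < l \<and> l < k \<longrightarrow> g l = 0"
  have "\<forall>l. j < l \<and> l < k \<longrightarrow> f l = 0" using g assms(1) jk(2) by auto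
  then show "sgn (g k) = - sgn (g j)"
    using assms(2)[unfolded alternating_fun_def, THEN spec, of j, THEN spec, of k] jk
      assms(1)[of j] assms(1)[of k] by simp
qed

lemma alternating_vec_iff_fun:
  assumes "dim_vec v = n" "\<And>l. l < n \<Longrightarrow> v $ l = f l"
  shows "alternating_vec v \<longleftrightarrow> alternating_fun n f"
proof -
  have "alternating_vec v \<longleftrightarrow> alternating_fun n (($) v)"
    by (simp add: alternating_vec_def alternating_fun_def assms(1))
  then show ?thesis using alternating_fun_cong[of n "($) v" f] alternating_fun_cong[of n f "($) v"] assms(2) by auto
qed

lemma ASM_iff_prefix_sums:
  "M \<in> ASM n \<longleftrightarrow> M \<in> carrier_mat n n \<and> (\<forall>i<n. prefix_sums_01 n (\<lambda>j. M $$ (i, j))) \<and>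
     (\<forall>j<n. prefix_sums_01 n (\<lambda>i. M $$ (i, j)))"
proof (cases "M \<in> carrier_mat n n")
  case True
  have "elements_mat M \<subseteq> {-1, 0, 1} \<longleftrightarrow> (\<forall>i<n. \<forall>j<n. M $$ (i, j) \<in> {-1, 0, 1})"
    using True by (simp add: elements_mat_def UN_subset_iff image_subset_iff Ball_def)
  moreover have "alternating_vec (row M i) \<longleftrightarrow> alternating_fun n (\<lambda>j. M $$ (i, j))" if "i < n" for i
    using that True by (intro alternating_vec_iff_fun) auto
  moreover have "alternating_vec (col M j) \<longleftrightarrow> alternating_fun n (\<lambda>i. M $$ (i, j))" if "j < n" for j
    using that True by (intro alternating_vec_iff_fun) auto
  ultimately show ?thesis using True by (auto simp: ASM_def prefix_sums_01_iff)
qed (simp add: ASM_def)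

text \<open>The changes of the auxiliary spin along a row, read as a row of an alternating sign matrix.\<close>

definition asm_rows :: "int \<Rightarrow> int \<Rightarrow> nat \<Rightarrow> int list set" where
  "asm_rows a b n = {m. length m = n \<and> (\<forall>j\<le>n. a + sum_list (take j m) \<in> {0, 1}) \<and> a + sum_list m = b}"

definition spin_int :: "spin_half \<Rightarrow> int" where
  "spin_int a = (if a = Up then 1 else 0)"

lemma spin_int_01: "spin_int a \<in> {0, 1}"
  by (simp add: spin_int_def)

lemma spin_int_range: "x \<in> {0, 1} \<longleftrightarrow> x \<in> range spin_int"
  by (auto simp: spin_int_def UNIV_spin_half)

lemma spin_int_inj: "spin_int a = spin_int b \<longleftrightarrow> a = b"
  by (cases a; cases b) (auto simp: spin_int_def)

lemma asm_rows_0: "asm_rows (spin_int a) (spin_int b) 0 = (if a = b then {[]} else {})"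
  using spin_int_01[of a] by (auto simp: asm_rows_def spin_int_inj)

text \<open>The shifted partial sums are the successive auxiliary spins, so choosing the first entry
  amounts to choosing the next spin \<open>c\<close>.\<close>

lemma asm_rows_Suc:
  "asm_rows (spin_int a) b (Suc n) =
    (\<Union>c\<in>UNIV. (#) (spin_int c - spin_int a) ` asm_rows (spin_int c) b n)"
proof (intro subset_antisym subsetI)
  fix m assume m: "m \<in> asm_rows (spin_int a) b (Suc n)"
  then obtain d m' where dm: "m = d # m'" "length m' = n" by (cases m) (auto simp: asm_rows_def)
  have P: "spin_int a + d + sum_list (take j m') \<in> {0, 1}" if "j \<le> n" for j
    using m that by (auto simp: asm_rows_def dm add.assoc dest!: spec[of _ "Suc j"])
  from P[of 0] obtain c where c: "spin_int c = spin_int a + d" using spin_int_range by force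
  then have "m' \<in> asm_rows (spin_int c) b n" using m P by (auto simp: asm_rows_def dm)
  then show "m \<in> (\<Union>c\<in>UNIV. (#) (spin_int c - spin_int a) ` asm_rows (spin_int c) b n)"
    unfolding dm by (intro UN_I[of c] image_eqI[of _ _ m']) (simp_all add: c)
next
  fix m assume "m \<in> (\<Union>c\<in>UNIV. (#) (spin_int c - spin_int a) ` asm_rows (spin_int c) b n)"
  then obtain c m' where cm: "m = (spin_int c - spin_int a) # m'" "m' \<in> asm_rows (spin_int c) b n" by auto
  have "spin_int a + sum_list (take j m) \<in> {0, 1}" if "j \<le> Suc n" for j
    using cm that spin_int_01[of a] by (cases j) (auto simp: asm_rows_def)
  then show "m \<in> asm_rows (spin_int a) b (Suc n)" using cm by (auto simp: asm_rows_def)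
qed

lemma finite_asm_rows: "finite (asm_rows (spin_int a) (spin_int b) n)"
  by (induction n arbitrary: a) (auto simp: asm_rows_0 asm_rows_Suc)

lemma sum_asm_rows_Suc:
  "(\<Sum>m\<in>asm_rows (spin_int a) (spin_int b) (Suc n). g m) =
    (\<Sum>c\<in>UNIV. \<Sum>m\<in>asm_rows (spin_int c) (spin_int b) n. g ((spin_int c - spin_int a) # m))"
  unfolding asm_rows_Suc
  by (subst sum.UNION_disjoint) (auto simp: finite_asm_rows spin_int_inj sum.reindex inj_on_def)

section \<open>Homogeneous six-vertex configurations as chains of integer rows\<close>

definition nonzeros :: "int list \<Rightarrow> nat" where
  "nonzeros m = length (filter (\<lambda>d. d \<noteq> 0) m)"

lemma br_power2: "q \<noteq> 0 \<Longrightarrow> br (q\<^sup>2) = br q * (q + inverse q)"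
  by (simp add: br_def field_simps power2_eq_square)

text \<open>At \<open>z = inverse q\<close> both diagonal weights are \<open>br q\<close>, and a
  flip of the auxiliary spin costs an extra \<open>q + inverse q\<close>. Conservation determines
  the incoming spin; a value outside 0 and 1 means that no vertex exists.\<close>

lemma six_vertex_sum:
  assumes "q \<noteq> 0"
  shows "(\<Sum>t\<in>UNIV. six_weight q (inverse q) a t c s * f (spin_int t)) =
    br q * (q + inverse q) ^ (if c = a then 0 else 1) *
      (if spin_int s + (spin_int c - spin_int a) \<in> {0, 1} then f (spin_int s + (spin_int c - spin_int a)) else 0)"
proof -
  have "q\<^sup>2 * inverse q = q" using assms by (simp add: power2_eq_square)
  then show ?thesis using assms
    by (cases a; cases c; cases s) (auto simp: UNIV_spin_half six_weight_def spin_int_def br_power2)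
qed

text \<open>A row configuration is encoded by the increments \<open>m\<close> of the auxiliary spin;
  by conservation the incoming site spins are the outgoing ones plus \<open>m\<close>.\<close>

lemma row_op_six_homogeneous:
  assumes "q \<noteq> 0" "length \<sigma> = n"
  shows "row_op (replicate n (six_weight q (inverse q))) a b (\<lambda>\<tau>. f (map spin_int \<tau>)) \<sigma> =
    (\<Sum>m\<in>asm_rows (spin_int a) (spin_int b) n. if set (map2 (+) (map spin_int \<sigma>) m) \<subseteq> {0, 1}
      then br q ^ n * (q + inverse q) ^ nonzeros m * f (map2 (+) (map spin_int \<sigma>) m) else 0)"
  using assms(2)
proof (induction n arbitrary: a f \<sigma>)
  case 0
  then show ?case by (simp add: asm_rows_0 nonzeros_def)
next
  case (Suc n)
  then obtain s \<rho> where s: "\<sigma> = s # \<rho>" "length \<rho> = n" by (cases \<sigma>) auto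
  let ?x = "q + inverse q"
  let ?g = "\<lambda>c m y. if set (map2 (+) (map spin_int \<rho>) m) \<subseteq> {0, 1}
      then br q ^ n * ?x ^ nonzeros m * f (y # map2 (+) (map spin_int \<rho>) m) else 0"
  have "row_op (replicate (Suc n) (six_weight q (inverse q))) a b (\<lambda>\<tau>. f (map spin_int \<tau>)) \<sigma> =
    (\<Sum>c\<in>UNIV. \<Sum>t\<in>UNIV. six_weight q (inverse q) a t c s *
      (\<Sum>m\<in>asm_rows (spin_int c) (spin_int b) n. ?g c m (spin_int t)))"
    using Suc.IH[OF s(2), of _ "\<lambda>l. f (_ # l)"] by (simp add: s)
  also have "\<dots> = (\<Sum>c\<in>UNIV. br q * ?x ^ (if c = a then 0 else 1) *
     (if spin_int s + (spin_int c - spin_int a) \<in> {0, 1} then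
       (\<Sum>m\<in>asm_rows (spin_int c) (spin_int b) n. ?g c m (spin_int s + (spin_int c - spin_int a))) else 0))"
    by (intro sum.cong refl six_vertex_sum assms)
  also have "\<dots> = (\<Sum>c\<in>UNIV. \<Sum>m\<in>asm_rows (spin_int c) (spin_int b) n.
      if set (map2 (+) (map spin_int \<sigma>) ((spin_int c - spin_int a) # m)) \<subseteq> {0, 1}
      then br q ^ Suc n * ?x ^ nonzeros ((spin_int c - spin_int a) # m) *
        f (map2 (+) (map spin_int \<sigma>) ((spin_int c - spin_int a) # m)) else 0)"
    by (intro sum.cong refl)
      (auto simp: s sum_distrib_left nonzeros_def spin_int_inj mult_ac intro!: sum.cong)
  finally show ?case by (simp only: sum_asm_rows_Suc)
qed

text \<open>Rows are listed against the direction of action, from the outgoing to the incoming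
  state. Started at zero, \<open>c\<close> holds the column sums of the rows read so far, which must
  stay in 0 and 1 and end at 1.\<close>

fun asm_chains :: "nat \<Rightarrow> nat \<Rightarrow> int list \<Rightarrow> int list list set" where
  "asm_chains 0 n c = (if c = replicate n 1 then {[]} else {})"
| "asm_chains (Suc k) n c = (\<Union>m\<in>{m \<in> asm_rows 0 1 n. set (map2 (+) c m) \<subseteq> {0, 1}}. (#) m ` asm_chains k n (map2 (+) c m))"

lemma finite_asm_rows_01: "finite (asm_rows 0 1 n)"
  using finite_asm_rows[of Down Up n] by (simp add: spin_int_def)

lemma finite_asm_chains: "finite (asm_chains k n c)"
  by (induction k arbitrary: c) (auto simp: finite_asm_rows_01)

lemma sum_asm_chains_Suc:
  "(\<Sum>ms\<in>asm_chains (Suc k) n c. g ms) = (\<Sum>m\<in>asm_rows 0 1 n. if set (map2 (+) c m) \<subseteq> {0, 1}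
     then (\<Sum>ms\<in>asm_chains k n (map2 (+) c m). g (m # ms)) else 0)"
  unfolding asm_chains.simps
  by (subst sum.UNION_disjoint)
    (auto simp: finite_asm_rows_01 finite_asm_chains sum.reindex inj_on_def intro!: sum.inter_filter)

lemma vm_rows_six_chains:
  assumes "q \<noteq> 0" "length \<sigma> = n"
  shows "vm_rows (six_weight q) (replicate k (inverse q)) (replicate n 1) (delta_state (replicate n Up)) \<sigma> =
    (\<Sum>ms\<in>asm_chains k n (map spin_int \<sigma>). br q ^ (k * n) * (q + inverse q) ^ sum_list (map nonzeros ms))"
  using assms(2)
proof (induction k arbitrary: \<sigma>)
  case 0
  have "map spin_int \<sigma> = replicate n 1 \<longleftrightarrow> \<sigma> = replicate n Up"
    using 0 by (auto simp: list_eq_iff_nth_eq spin_int_def split: if_splits)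
  then show ?case by (simp add: delta_state_def)
next
  case (Suc k)
  let ?f = "\<lambda>c. \<Sum>ms\<in>asm_chains k n c. br q ^ (k * n) * (q + inverse q) ^ sum_list (map nonzeros ms)"
  have "vm_rows (six_weight q) (replicate (Suc k) (inverse q)) (replicate n 1) (delta_state (replicate n Up)) \<sigma> =
    row_op (replicate n (six_weight q (inverse q))) Down Up (\<lambda>\<tau>. ?f (map spin_int \<tau>)) \<sigma>"
    unfolding vm_rows_Cons vm_row_def replicate_Suc map_replicate using Suc by (simp, intro row_op_cong) auto
  also have "\<dots> = (\<Sum>m\<in>asm_rows 0 1 n. if set (map2 (+) (map spin_int \<sigma>) m) \<subseteq> {0, 1}
      then br q ^ n * (q + inverse q) ^ nonzeros m * ?f (map2 (+) (map spin_int \<sigma>) m) else 0)"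
    using row_op_six_homogeneous[OF assms(1) Suc.prems, of Down Up ?f] by (simp add: spin_int_def)
  finally show ?case
    unfolding sum_asm_chains_Suc
    by (auto simp: sum_distrib_left power_add mult_ac intro!: sum.cong)
qed

text \<open>Unrolls the recursion into conditions on partial column sums, offset by
  \<open>c\<close>; for \<open>c = 0\<close> these are the column conditions of an alternating sign
  matrix.\<close>

lemma asm_chains_iff:
  assumes "length c = n" "set c \<subseteq> {0, 1}"
  shows "ms \<in> asm_chains k n c \<longleftrightarrow> length ms = k \<and> set ms \<subseteq> asm_rows 0 1 n \<and>
    (\<forall>j<n. (\<forall>i\<le>k. c ! j + (\<Sum>l<i. ms ! l ! j) \<in> {0, 1}) \<and> c ! j + (\<Sum>l<k. ms ! l ! j) = 1)"
  using assms
proof (induction k arbitrary: c ms)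
  case 0
  then have "c = replicate n 1 \<longleftrightarrow> (\<forall>j<n. c ! j = 1)" by (auto simp: list_eq_iff_nth_eq)
  moreover have "\<forall>j<n. c ! j \<in> {0, 1}" using 0 by (auto dest: nth_mem)
  ultimately show ?case by auto
next
  case (Suc k)
  show ?case
  proof (cases ms)
    case (Cons m ms')
    have all: "(\<forall>i\<le>Suc k. P i) \<longleftrightarrow> P 0 \<and> (\<forall>i\<le>k. P (Suc i))" for P
      by (metis Suc_le_mono le0 not0_implies_Suc)
    show ?thesis
    proof (cases "length m = n")
      case True
      let ?c = "map2 (+) c m"
      have c01: "\<forall>j<n. c ! j \<in> {0, 1}" using Suc.prems by (auto dest: nth_mem)
      have len: "length ?c = n" using True Suc.prems by simp
      have nth: "?c ! j = c ! j + m ! j" if "j < n" for j using that True Suc.prems by simp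
      have sub: "set ?c \<subseteq> {0, 1} \<longleftrightarrow> (\<forall>j<n. c ! j + m ! j \<in> {0, 1})"
      proof -
        have "set ?c \<subseteq> {0, 1} \<longleftrightarrow> (\<forall>x\<in>set ?c. x \<in> {0, 1})" by blast
        also have "\<dots> \<longleftrightarrow> (\<forall>j<n. ?c ! j \<in> {0, 1})" by (simp only: all_set_conv_all_nth len)
        finally show ?thesis using nth by simp
      qed
      have S: "(\<Sum>l<Suc i. ms ! l ! j) = m ! j + (\<Sum>l<i. ms' ! l ! j)" for i j
        by (simp add: Cons sum.lessThan_Suc_shift del: sum.lessThan_Suc)
      have pt: "(\<forall>i\<le>Suc k. c ! j + (\<Sum>l<i. ms ! l ! j) \<in> {0, 1}) \<and> c ! j + (\<Sum>l<Suc k. ms ! l ! j) = 1 \<longleftrightarrow>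
          (\<forall>i\<le>k. c ! j + m ! j + (\<Sum>l<i. ms' ! l ! j) \<in> {0, 1}) \<and> c ! j + m ! j + (\<Sum>l<k. ms' ! l ! j) = 1"
        if "j < n" for j
        unfolding all S using c01 that by (simp add: add.assoc)
      have zero: "c ! j + m ! j \<in> {0, 1}" if "\<forall>i\<le>k. c ! j + m ! j + (\<Sum>l<i. ms' ! l ! j) \<in> {0, 1}" for j
        using that[rule_format, of 0] by simp
      have "ms \<in> asm_chains (Suc k) n c \<longleftrightarrow> m \<in> asm_rows 0 1 n \<and> set ?c \<subseteq> {0, 1} \<and> ms' \<in> asm_chains k n ?c"
        using Cons by auto
      also have "\<dots> \<longleftrightarrow> m \<in> asm_rows 0 1 n \<and> set ?c \<subseteq> {0, 1} \<and> length ms' = k \<and> set ms' \<subseteq> asm_rows 0 1 n \<and>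
          (\<forall>j<n. (\<forall>i\<le>k. c ! j + m ! j + (\<Sum>l<i. ms' ! l ! j) \<in> {0, 1}) \<and> c ! j + m ! j + (\<Sum>l<k. ms' ! l ! j) = 1)"
        using Suc.IH[OF len] nth by auto
      also have "\<dots> \<longleftrightarrow> length ms = Suc k \<and> set ms \<subseteq> asm_rows 0 1 n \<and>
        (\<forall>j<n. (\<forall>i\<le>Suc k. c ! j + (\<Sum>l<i. ms ! l ! j) \<in> {0, 1}) \<and> c ! j + (\<Sum>l<Suc k. ms ! l ! j) = 1)"
        using pt zero unfolding sub Cons by (simp del: sum.lessThan_Suc insert_iff) blast
      finally show ?thesis .
    next
      case False
      then show ?thesis using Cons by (auto simp: asm_rows_def)
    qed
  qed auto
qed

section \<open>From chains of rows to alternating sign matrices\<close>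

lemma sum_list_take_nth: "j \<le> length m \<Longrightarrow> sum_list (take j m) = (\<Sum>l<j. m ! l)"
  by (simp add: sum_list_sum_nth atLeast0LessThan)

lemma asm_rows_iff: "m \<in> asm_rows 0 1 n \<longleftrightarrow> length m = n \<and> prefix_sums_01 n ((!) m)"
  by (auto simp: asm_rows_def prefix_sums_01_def sum_list_take_nth sum_list_sum_nth atLeast0LessThan)

lemma sum_list_Suc_double: "(\<Sum>m\<leftarrow>ms. Suc (2 * f m)) = length ms + 2 * sum_list (map f ms)"
  by (induction ms) auto

definition negatives :: "int list \<Rightarrow> nat" where
  "negatives m = length (filter (\<lambda>d. d = - 1) m)"

text \<open>The entries sum to 1, so there is one more entry 1 than entries -1.\<close>

lemma nonzeros_asm_row:
  assumes "m \<in> asm_rows 0 1 n"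
  shows "nonzeros m = 1 + 2 * negatives m"
proof -
  have "\<forall>d\<in>set m. d \<in> {-1, 0, 1}"
    using assms prefix_sums_01_imp_alternating(1)[of n "(!) m"] by (auto simp: asm_rows_iff in_set_conv_nth)
  then have "int (nonzeros m) = sum_list m + 2 * int (negatives m)"
    by (induction m) (auto simp: nonzeros_def negatives_def)
  moreover have "sum_list m = 1" using assms by (simp add: asm_rows_def)
  ultimately show ?thesis by simp
qed

lemma num_neg_mat:
  assumes "length ms = n" "\<And>m. m \<in> set ms \<Longrightarrow> length m = n"
  shows "num_neg (mat n n (\<lambda>(i, j). ms ! i ! j)) = sum_list (map negatives ms)"
proof -
  have "{(i, j). i < n \<and> j < n \<and> mat n n (\<lambda>(i, j). ms ! i ! j) $$ (i, j) = -1} =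
    (SIGMA i:{..<n}. {j. j < n \<and> ms ! i ! j = -1})" by auto
  then have "num_neg (mat n n (\<lambda>(i, j). ms ! i ! j)) = (\<Sum>i<n. card {j. j < n \<and> ms ! i ! j = -1})"
    by (simp add: num_neg_def)
  also have "\<dots> = (\<Sum>i<n. negatives (ms ! i))"
    using assms by (intro sum.cong) (auto simp: negatives_def length_filter_conv_card)
  finally show ?thesis using assms by (simp add: sum_list_sum_nth atLeast0LessThan)
qed

text \<open>By the count of non-zero entries, each of the \<open>n\<close> rows contributes one
  \<open>x\<close>, and each entry -1 contributes \<open>x\<^sup>2\<close>.\<close>

lemma sum_asm_chains_eq_ASM:
  "(\<Sum>ms\<in>asm_chains n n (replicate n 0). x ^ sum_list (map nonzeros ms)) =
    x ^ n * (\<Sum>M\<in>ASM n. (x\<^sup>2) ^ num_neg M :: complex)"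
proof -
  let ?M = "\<lambda>ms. mat n n (\<lambda>(i, j). ms ! i ! j)" and ?L = "\<lambda>M. map (\<lambda>i. map (\<lambda>j. M $$ (i, j)) [0..<n]) [0..<n]"
  have iff: "ms \<in> asm_chains n n (replicate n 0) \<longleftrightarrow> length ms = n \<and> (\<forall>i<n. length (ms ! i) = n \<and> prefix_sums_01 n ((!) (ms ! i))) \<and>
      (\<forall>j<n. prefix_sums_01 n (\<lambda>i. ms ! i ! j))" for ms
    by (subst asm_chains_iff) (auto simp: prefix_sums_01_def[of n "\<lambda>i. ms ! i ! _"] asm_rows_iff subset_iff all_set_conv_all_nth in_set_conv_nth)
  have cong: "prefix_sums_01 n f \<longleftrightarrow> prefix_sums_01 n g" if "\<And>l. l < n \<Longrightarrow> f l = g l" for f g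
  proof -
    have "(\<Sum>l<j. f l) = (\<Sum>l<j. g l)" if "j \<le> n" for j
      using that \<open>\<And>l. l < n \<Longrightarrow> f l = g l\<close> by (intro sum.cong) auto
    then show ?thesis by (auto simp: prefix_sums_01_def)
  qed
  have "(\<Sum>ms\<in>asm_chains n n (replicate n 0). x ^ sum_list (map nonzeros ms)) = (\<Sum>M\<in>ASM n. x ^ n * (x\<^sup>2) ^ num_neg M)"
  proof (rule sum.reindex_bij_witness[where j = ?M and i = ?L])
    fix ms assume ms: "ms \<in> asm_chains n n (replicate n 0)"
    then have len: "length ms = n" "\<And>i. i < n \<Longrightarrow> length (ms ! i) = n" by (auto simp: iff)
    then show "?L (?M ms) = ms" by (auto simp: list_eq_iff_nth_eq)
    have row: "prefix_sums_01 n (\<lambda>j. ?M ms $$ (i, j)) \<longleftrightarrow> prefix_sums_01 n ((!) (ms ! i))" if "i < n" for i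
      using that by (intro cong) simp
    have col: "prefix_sums_01 n (\<lambda>i. ?M ms $$ (i, j)) \<longleftrightarrow> prefix_sums_01 n (\<lambda>i. ms ! i ! j)" if "j < n" for j
      using that by (intro cong) simp
    show "?M ms \<in> ASM n" using ms by (simp add: ASM_iff_prefix_sums iff row col)
    have rows: "m \<in> asm_rows 0 1 n" if "m \<in> set ms" for m
      using ms that by (auto simp: iff in_set_conv_nth asm_rows_iff)
    then have "sum_list (map nonzeros ms) = sum_list (map (\<lambda>m. 1 + 2 * negatives m) ms)"
      by (intro arg_cong[of _ _ sum_list] map_cong refl nonzeros_asm_row)
    also have "\<dots> = n + 2 * num_neg (?M ms)"
      using len rows by (subst num_neg_mat) (auto simp: sum_list_Suc_double asm_rows_def)
    finally show "x ^ n * (x\<^sup>2) ^ num_neg (?M ms) = x ^ sum_list (map nonzeros ms)"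
      by (simp add: power_add power_mult)
  next
    fix M assume M: "M \<in> ASM n"
    then have c: "M \<in> carrier_mat n n" by (simp add: ASM_def)
    then show "?M (?L M) = M" by (intro eq_matI) auto
    have row: "prefix_sums_01 n ((!) (?L M ! i)) \<longleftrightarrow> prefix_sums_01 n (\<lambda>j. M $$ (i, j))" if "i < n" for i
      using that by (intro cong) simp
    have col: "prefix_sums_01 n (\<lambda>i. ?L M ! i ! j) \<longleftrightarrow> prefix_sums_01 n (\<lambda>i. M $$ (i, j))" if "j < n" for j
      using that by (intro cong) simp
    have len: "length (?L M ! i) = n" if "i < n" for i using that by simp
    show "?L M \<in> asm_chains n n (replicate n 0)"
      using M len by (simp add: ASM_iff_prefix_sums iff row col del: nth_map)
  qed
  then show ?thesis by (simp add: sum_distrib_left)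
qed

lemma six_dwpf_homogeneous:
  assumes "q \<noteq> 0"
  shows "dwpf Up Down (six_weight q) (replicate n (inverse q)) (replicate n 1) =
    br q ^ (n\<^sup>2) * (q + inverse q) ^ n * (\<Sum>M\<in>ASM n. ((q + inverse q)\<^sup>2) ^ num_neg M)"
  using vm_rows_six_chains[OF assms, of "replicate n Down" n n] sum_asm_chains_eq_ASM[of "q + inverse q" n]
  by (simp add: dwpf_def spin_int_def power2_eq_square mult.assoc flip: sum_distrib_left)

section \<open>The components of the zero-energy state\<close>

text \<open>What remains is to cancel powers: the \<open>2 * n\<close>-th power of the root is
  \<open>br q ^ (2 * n)\<close> times the surplus \<open>(q + inverse q) ^ n\<close> of the
  six-vertex sum. For odd length the one extra root is the weight \<open>s\<close> from the middle
  column.\<close>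

lemma phi_D_generic_components:
  fixes q :: complex and n :: nat
  assumes "q \<noteq> 0" "q ^ 4 \<noteq> 1" "sqrt_choice r"
  defines "A \<equiv> \<Sum>M\<in>ASM n. ((q + inverse q)\<^sup>2) ^ num_neg M"
  shows "phi_D_generic r (2 * n) q (replicate n UUp @ replicate n DDown) = A"
    and "phi_D_generic r (2 * n + 1) q (replicate n UUp @ [Zero] @ replicate n DDown) = A"
proof -
  let ?x = "q + inverse q" and ?s = "r q" and ?b = "br q"
  have s: "?s\<^sup>2 = ?b * br (q\<^sup>2)" using assms by (simp add: sqrt_choice_def)
  \<comment> \<open>These two values of \<open>q\<^sup>2\<close> are the zeros of
    \<open>br q\<close> and of \<open>q + inverse q\<close>.\<close>
  have "q\<^sup>2 \<noteq> 1" "q\<^sup>2 \<noteq> - 1"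
    using assms(2) by (auto simp: power4_eq_xxxx power2_eq_square mult.assoc)
  then have nz: "?b \<noteq> 0" "?x \<noteq> 0"
    using assms(1) by (auto simp: br_eq_0_iff field_simps power2_eq_square add_eq_0_iff)
  then have s0: "?s \<noteq> 0" using s br_power2[OF assms(1)] by auto
  have s2n: "?s ^ (2 * n) = ?b ^ (2 * n) * ?x ^ n"
    unfolding power_mult s br_power2[OF assms(1)] by (simp add: power_mult_distrib power2_eq_square)
  then have s2n1: "?s ^ (2 * n + 1) = ?s * (?b ^ (2 * n) * ?x ^ n)" by simp
  have F: "dwpf UUp DDown (spin1_weight q ?s) (replicate (2 * n) (inverse q)) (replicate n 1) = ?b ^ (2 * n * n) * ?x ^ n * A"
  proof -
    have "2 * n * n = n\<^sup>2 + n\<^sup>2" by (simp add: power2_eq_square)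
    then have "?b ^ (2 * n * n) = ?b ^ (n\<^sup>2) * ?b ^ (n\<^sup>2)" by (simp only: power_add)
    then show ?thesis
      by (simp only: spin1_dwpf_homogeneous[OF assms(1,2) s] six_dwpf_homogeneous[OF assms(1)] A_def mult.assoc)
  qed
  \<comment> \<open>The case \<open>n = 0\<close> is split off because \<open>2 * n - 1\<close> is
    truncated there.\<close>
  have "2 * n * n + 2 * n * n = 2 * n + 2 * n * (2 * n - 1)" by (cases n) (simp_all add: algebra_simps)
  then have e: "?b ^ (2 * n * n) * ?b ^ (2 * n * n) = ?b ^ (2 * n) * ?b ^ (2 * n * (2 * n - 1))"
    by (simp only: power_add[symmetric])
  have "phi_D_generic r (2 * n) q (replicate n UUp @ replicate n DDown) =
    (?b ^ (2 * n * n) * ?b ^ (2 * n * n)) * ?x ^ n * A / (?s ^ (2 * n) * ?b ^ (2 * n * (2 * n - 1)))"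
    unfolding phi_D_generic_def even_component F by (simp only: divide_inverse inverse_mult_distrib mult_ac)
  also have "\<dots> = A" unfolding e s2n using nz by simp
  finally show "phi_D_generic r (2 * n) q (replicate n UUp @ replicate n DDown) = A" .
  have "2 * n * n + 4 * n + 2 * n * n = 2 * n + (2 * n + 1) * (2 * n + 1 - 1)" by (simp add: algebra_simps)
  then have e': "?b ^ (2 * n * n + 4 * n) * ?b ^ (2 * n * n) = ?b ^ (2 * n) * ?b ^ ((2 * n + 1) * (2 * n + 1 - 1))"
    by (simp only: power_add[symmetric])
  have "phi_D_generic r (2 * n + 1) q (replicate n UUp @ [Zero] @ replicate n DDown) =
    ?s * ((?b ^ (2 * n * n + 4 * n) * ?b ^ (2 * n * n)) * ?x ^ n * A) / (?s ^ (2 * n + 1) * ?b ^ ((2 * n + 1) * (2 * n + 1 - 1)))"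
    unfolding phi_D_generic_def odd_component[OF assms(1)] F by (simp only: divide_inverse inverse_mult_distrib mult_ac)
  also have "\<dots> = A" unfolding e' s2n1 using nz s0 by simp
  finally show "phi_D_generic r (2 * n + 1) q (replicate n UUp @ [Zero] @ replicate n DDown) = A" .
qed

lemma eventually_not_fourth_root:
  fixes q :: complex
  shows "\<forall>\<^sub>F p in at q. p ^ 4 \<noteq> 1"
proof -
  let ?P = "monom 1 4 - 1 :: complex poly"
  have "?P \<noteq> 0"
  proof
    assume "?P = 0"
    then have "poly ?P 0 = 0" by simp
    then show False by (simp add: poly_monom)
  qed
  then have "finite {p. poly ?P p = 0}" by (rule poly_roots_finite)
  then have "finite {p :: complex. p ^ 4 = 1}" by (simp add: poly_monom)
  \<comment> \<open>The point \<open>q\<close> may itself be a fourth root of unity; it is taken out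
    of the closed set, as \<open>at q\<close> ignores it.\<close>
  then have "open (- ({p. p ^ 4 = 1} - {q}))" by (intro open_Compl finite_imp_closed) simp
  then have "\<forall>\<^sub>F p in nhds q. p \<in> - ({p. p ^ 4 = 1} - {q})" by (rule eventually_nhds_in_open) simp
  then show ?thesis by (auto simp: eventually_at_filter elim: eventually_mono)
qed

text \<open>At a fourth root of unity the generic formula holds in a punctured neighbourhood, so
  continuity of \<open>A\<close> identifies the limit in \<open>phi_D\<close>.\<close>

lemma phi_D_eq_ASM_sum:
  assumes "q \<noteq> 0" "isCont A q"
    and gen: "\<And>p. p \<noteq> 0 \<Longrightarrow> p ^ 4 \<noteq> 1 \<Longrightarrow> phi_D_generic r N p \<sigma> = A p"
  shows "phi_D r N q \<sigma> = A q"
proof (cases "q ^ 4 = 1")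
  case True
  have "\<forall>\<^sub>F p in at q. p \<noteq> 0" using assms(1) by (intro t1_space_class.eventually_neq_at_within)
  with eventually_not_fourth_root[of q] have "\<forall>\<^sub>F p in at q. A p = phi_D_generic r N p \<sigma>"
    by eventually_elim (simp add: gen)
  moreover have "(A \<longlongrightarrow> A q) (at q)" using assms(2) by (simp add: isCont_def)
  ultimately have "((\<lambda>p. phi_D_generic r N p \<sigma>) \<longlongrightarrow> A q) (at q)" by (rule Lim_transform_eventually[rotated])
  then have "Lim (at q) (\<lambda>p. phi_D_generic r N p \<sigma>) = A q" by (intro tendsto_Lim) simp
  then show ?thesis using True by (simp add: phi_D_def)
next
  case False
  then show ?thesis using assms(1) gen by (simp add: phi_D_def)
qed

theorem theorem2p11:
  fixes x :: real and q :: complex and r :: "complex \<Rightarrow> complex" and n :: nat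
  assumes "q \<noteq> 0"
    and "complex_of_real x = q + inverse q"
    and "sqrt_choice r"
  shows "phi_D r (2 * n) q (replicate n UUp @ replicate n DDown)
           = complex_of_real (ASM_gf n (x\<^sup>2)) \<and>
         phi_D r (2 * n + 1) q (replicate n UUp @ [Zero] @ replicate n DDown)
           = complex_of_real (ASM_gf n (x\<^sup>2))"
proof -
  let ?A = "\<lambda>p. \<Sum>M\<in>ASM n. ((p + inverse p)\<^sup>2) ^ num_neg M"
  have "isCont ?A q" using assms(1) by (intro continuous_intros)
  moreover have "?A q = complex_of_real (ASM_gf n (x\<^sup>2))"
    by (simp add: ASM_gf_def assms(2)[symmetric])
  ultimately show ?thesis
    using phi_D_eq_ASM_sum[OF assms(1), of ?A] phi_D_generic_components[OF _ _ assms(3)] by simp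
qed

end
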